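(* Let $L\ge 1$, weights $w_1,\dots,w_L>0$, a power budget $P_{\mathrm T}>0$, and complex channel matrices $\mathbf H_{l,k}\in\mathbb C^{L_{R_l}\times L_{T_k}}$ ($l,k=1,\dots,L$) be given. Let $\{\mathbf\Sigma^{(n)}\}_{n\ge 0}$ be the sequence of forward covariance tuples produced by the Dual Link Algorithm (defined in the context) from an initial point $\mathbf\Sigma^{(0)}$ with $\mathbf\Sigma^{(0)}_l\succeq 0$ for all $l$ and $\sum_l\mathrm{Tr}(\mathbf\Sigma^{(0)}_l)=P_{\mathrm T}$, and assume all the normalizing denominators in the algorithm are strictly positive at every iteration, so that the algorithm is well defined. Then the weighted sum-rate is monotonically nondecreasing along the iterations: $V(\mathbf\Sigma^{(n)})\le V(\mathbf\Sigma^{(n+1)})$ for all $n\ge 0$.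
   Context: For Hermitian positive semidefinite $\mathbf\Sigma_l\in\mathbb C^{L_{T_l}\times L_{T_l}}$, $l=1,\dots,L$, write $\mathbf\Sigma=\mathbf\Sigma_{1:L}$ and define the forward interference-plus-noise covariances $\mathbf\Omega_l=\mathbf I+\sum_{k\ne l}\mathbf H_{l,k}\mathbf\Sigma_k\mathbf H_{l,k}^\dagger$. The weighted sum-rate is $V(\mathbf\Sigma)=\sum_{l=1}^L w_l\big(\log|\mathbf\Omega_l+\mathbf H_{l,l}\mathbf\Sigma_l\mathbf H_{l,l}^\dagger|-\log|\mathbf\Omega_l|\big)$, where $|\cdot|$ is the determinant and $^\dagger$ the conjugate transpose. Dual Link Algorithm: given $\mathbf\Sigma^{(n)}$ (with total trace $P_{\mathrm T}$), compute (i) $\mathbf\Omega_l=\mathbf I+\sum_{k\ne l}\mathbf H_{l,k}\mathbf\Sigma^{(n)}_k\mathbf H_{l,k}^\dagger$; (ii) $\hat{\mathbf\Sigma}_l=\dfrac{P_{\mathrm T}\,w_l\big(\mathbf\Omega_l^{-1}-(\mathbf\Omega_l+\mathbf H_{l,l}\mathbf\Sigma^{(n)}_l\mathbf H_{l,l}^\dagger)^{-1}\big)}{\sum_{j=1}^L w_j\,\mathrm{Tr}\big(\mathbf\Omega_j^{-1}-(\mathbf\Omega_j+\mathbf H_{j,j}\mathbf\Sigma^{(n)}_j\mathbf H_{j,j}^\dagger)^{-1}\big)}$; (iii) $\hat{\mathbf\Omega}_l=\mathbf I+\sum_{k\ne l}\mathbf H_{k,l}^\dagger\hat{\mathbf\Sigma}_k\mathbf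 H_{k,l}$; (iv) $\mathbf\Sigma^{(n+1)}_l=\dfrac{P_{\mathrm T}\,w_l\big(\hat{\mathbf\Omega}_l^{-1}-(\hat{\mathbf\Omega}_l+\mathbf H_{l,l}^\dagger\hat{\mathbf\Sigma}_l\mathbf H_{l,l})^{-1}\big)}{\sum_{j=1}^L w_j\,\mathrm{Tr}\big(\hat{\mathbf\Omega}_j^{-1}-(\hat{\mathbf\Omega}_j+\mathbf H_{j,j}^\dagger\hat{\mathbf\Sigma}_j\mathbf H_{j,j})^{-1}\big)}$, for $l=1,\dots,L$. *)

theory Defs
  imports "Jordan_Normal_Form.Schur_Decomposition"
begin

(* Links are indexed 0..L-1.  Matrices are Jordan_Normal_Form complex matrices.
   H l k : channel from transmitter k to receiver l, of size LR l x LT k.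
   S l   : transmit covariance of link l (LT l x LT l).
   mat_adjoint = conjugate transpose. *)

definition mtrace :: "complex mat \<Rightarrow> complex" where
  "mtrace A = (\<Sum>i<dim_row A. A $$ (i, i))"

definition minv :: "complex mat \<Rightarrow> complex mat" where
  "minv A = (SOME B. B \<in> carrier_mat (dim_row A) (dim_row A) \<and> inverts_mat A B \<and> inverts_mat B A)"

definition hermitian_psd :: "nat \<Rightarrow> complex mat \<Rightarrow> bool" where
  "hermitian_psd n A \<longleftrightarrow> A \<in> carrier_mat n n \<and> mat_adjoint A = A \<and>
     (\<forall>x \<in> carrier_vec n. 0 \<le> Re (conjugate x \<bullet> (A *\<^sub>v x)))"

definition logdet :: "complex mat \<Rightarrow> real" where
  "logdet A = ln (Re (det A))"

definition fwd_Omega :: "nat \<Rightarrow> (nat \<Rightarrow> nat) \<Rightarrow> (nat \<Rightarrow> nat \<Rightarrow> complex mat)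
    \<Rightarrow> (nat \<Rightarrow> complex mat) \<Rightarrow> nat \<Rightarrow> complex mat" where
  "fwd_Omega L LR H S l =
     foldr (\<lambda>k A. H l k * S k * mat_adjoint (H l k) + A)
       (filter (\<lambda>k. k \<noteq> l) [0..<L]) (1\<^sub>m (LR l))"

definition rev_Omega :: "nat \<Rightarrow> (nat \<Rightarrow> nat) \<Rightarrow> (nat \<Rightarrow> nat \<Rightarrow> complex mat)
    \<Rightarrow> (nat \<Rightarrow> complex mat) \<Rightarrow> nat \<Rightarrow> complex mat" where
  "rev_Omega L LT H S l =
     foldr (\<lambda>k A. mat_adjoint (H k l) * S k * H k l + A)
       (filter (\<lambda>k. k \<noteq> l) [0..<L]) (1\<^sub>m (LT l))"

definition wsr :: "nat \<Rightarrow> (nat \<Rightarrow> real) \<Rightarrow> (nat \<Rightarrow> nat) \<Rightarrow> (nat \<Rightarrow> nat \<Rightarrow> complex mat)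
    \<Rightarrow> (nat \<Rightarrow> complex mat) \<Rightarrow> real" where
  "wsr L w LR H S = (\<Sum>l<L. w l *
      (logdet (fwd_Omega L LR H S l + H l l * S l * mat_adjoint (H l l))
       - logdet (fwd_Omega L LR H S l)))"

definition fwd_grad :: "nat \<Rightarrow> (nat \<Rightarrow> nat) \<Rightarrow> (nat \<Rightarrow> nat \<Rightarrow> complex mat)
    \<Rightarrow> (nat \<Rightarrow> complex mat) \<Rightarrow> nat \<Rightarrow> complex mat" where
  "fwd_grad L LR H S l =
     minv (fwd_Omega L LR H S l) - minv (fwd_Omega L LR H S l + H l l * S l * mat_adjoint (H l l))"

definition rev_grad :: "nat \<Rightarrow> (nat \<Rightarrow> nat) \<Rightarrow> (nat \<Rightarrow> nat \<Rightarrow> complex mat)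
    \<Rightarrow> (nat \<Rightarrow> complex mat) \<Rightarrow> nat \<Rightarrow> complex mat" where
  "rev_grad L LT H S l =
     minv (rev_Omega L LT H S l) - minv (rev_Omega L LT H S l + mat_adjoint (H l l) * S l * H l l)"

definition fwd_denom :: "nat \<Rightarrow> (nat \<Rightarrow> real) \<Rightarrow> (nat \<Rightarrow> nat) \<Rightarrow> (nat \<Rightarrow> nat \<Rightarrow> complex mat)
    \<Rightarrow> (nat \<Rightarrow> complex mat) \<Rightarrow> complex" where
  "fwd_denom L w LR H S = (\<Sum>j<L. complex_of_real (w j) * mtrace (fwd_grad L LR H S j))"

definition rev_denom :: "nat \<Rightarrow> (nat \<Rightarrow> real) \<Rightarrow> (nat \<Rightarrow> nat) \<Rightarrow> (nat \<Rightarrow> nat \<Rightarrow> complex mat)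
    \<Rightarrow> (nat \<Rightarrow> complex mat) \<Rightarrow> complex" where
  "rev_denom L w LT H S = (\<Sum>j<L. complex_of_real (w j) * mtrace (rev_grad L LT H S j))"

definition dla_rev :: "nat \<Rightarrow> (nat \<Rightarrow> real) \<Rightarrow> real \<Rightarrow> (nat \<Rightarrow> nat) \<Rightarrow> (nat \<Rightarrow> nat \<Rightarrow> complex mat)
    \<Rightarrow> (nat \<Rightarrow> complex mat) \<Rightarrow> nat \<Rightarrow> complex mat" where
  "dla_rev L w PT LR H S l =
     ((complex_of_real (PT * w l)) / fwd_denom L w LR H S) \<cdot>\<^sub>m fwd_grad L LR H S l"

definition dla_step :: "nat \<Rightarrow> (nat \<Rightarrow> real) \<Rightarrow> real \<Rightarrow> (nat \<Rightarrow> nat) \<Rightarrow> (nat \<Rightarrow> nat)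
    \<Rightarrow> (nat \<Rightarrow> nat \<Rightarrow> complex mat) \<Rightarrow> (nat \<Rightarrow> complex mat) \<Rightarrow> nat \<Rightarrow> complex mat" where
  "dla_step L w PT LT LR H S l =
     (let Sh = dla_rev L w PT LR H S in
      ((complex_of_real (PT * w l)) / rev_denom L w LT H Sh) \<cdot>\<^sub>m rev_grad L LT H Sh l)"

end

theory Submission
  imports Defs
begin

text \<open>
  Conjugate-transposing all channels exchanges the two halves of an iteration, so it suffices that
  one half-step, from \<open>\<Sigma>\<close> to its dual \<open>R\<close>, does not decrease the sum-rate (measured in the
  transposed network after the step). Link by link this follows from the inequality

    \<open>ln |\<Theta> + H\<^sup>*\<Lambda>H| - ln |\<Theta>| \<le> ln |\<Omega> + HSH\<^sup>*| - ln |\<Omega>| + Tr \<Lambda>\<Omega> - Tr \<Theta>S\<close>,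
    \<open>S = inverse \<Theta> - inverse (\<Theta> + H\<^sup>*\<Lambda>H)\<close>,

  valid for all positive definite \<open>\<Theta>\<close>, \<open>\<Omega>\<close> and positive semidefinite \<open>\<Lambda>\<close>. Summed over the links,
  the trace terms cancel: the interference contributions agree because the trace is cyclic, and the
  noise contributions because \<open>\<Sigma>\<close> and \<open>R\<close> use the same total power.

  The inequality itself comes from a factorization \<open>\<Lambda> = CC\<^sup>*\<close>, Sylvester's determinant identity
  and \<open>ln |X| \<le> Tr X - m\<close>, applied to \<open>X = W (inverse M) W\<close> where
  \<open>W = 1 + C\<^sup>*H (inverse \<Theta>) H\<^sup>*C\<close>, \<open>Y = H (inverse \<Theta>) H\<^sup>*C\<close> and \<open>M = W + Y\<^sup>*(inverse \<Omega>) Y\<close>.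
\<close>

subsection \<open>Matrix algebra\<close>

lemma mat_adjoint_dim [simp]:
  "dim_row (mat_adjoint A) = dim_col A" "dim_col (mat_adjoint A) = dim_row A"
  unfolding mat_adjoint_def by simp_all

lemma mat_adjoint_carrier [simp]:
  "mat_adjoint A \<in> carrier_mat n m \<longleftrightarrow> A \<in> carrier_mat m n"
  unfolding carrier_mat_def by auto

lemma mat_adjoint_index [simp]:
  "i < dim_col A \<Longrightarrow> j < dim_row A \<Longrightarrow> mat_adjoint A $$ (i, j) = conjugate (A $$ (j, i))"
  unfolding mat_adjoint_def by (simp add: mat_of_rows_index)

lemma mat_adjoint_adjoint [simp]: "mat_adjoint (mat_adjoint A) = A"
  by (rule eq_matI) auto

lemma mat_adjoint_one [simp]: "mat_adjoint (1\<^sub>m n :: complex mat) = 1\<^sub>m n"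
  by (rule eq_matI) auto

lemma mat_adjoint_add:
  fixes A B :: "complex mat"
  assumes "dim_row A = dim_row B" "dim_col A = dim_col B"
  shows "mat_adjoint (A + B) = mat_adjoint A + mat_adjoint B"
  using assms by (intro eq_matI) auto

lemma mat_adjoint_minus:
  fixes A B :: "complex mat"
  assumes "dim_row A = dim_row B" "dim_col A = dim_col B"
  shows "mat_adjoint (A - B) = mat_adjoint A - mat_adjoint B"
  using assms by (intro eq_matI) auto

lemma mat_adjoint_smult:
  "mat_adjoint (c \<cdot>\<^sub>m A) = cnj c \<cdot>\<^sub>m mat_adjoint A" for A :: "complex mat"
  by (rule eq_matI) auto

lemma mat_mult_index_sum:
  "i < dim_row A \<Longrightarrow> j < dim_col B \<Longrightarrow> dim_col A = dim_row B \<Longrightarrow>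
    (A * B) $$ (i, j) = (\<Sum>k<dim_row B. A $$ (i, k) * B $$ (k, j))"
  by (simp add: scalar_prod_def lessThan_atLeast0)

lemma mat_adjoint_mult:
  fixes A B :: "complex mat"
  assumes "dim_col A = dim_row B"
  shows "mat_adjoint (A * B) = mat_adjoint B * mat_adjoint A"
proof (rule eq_matI)
  fix i j
  assume "i < dim_row (mat_adjoint B * mat_adjoint A)" "j < dim_col (mat_adjoint B * mat_adjoint A)"
  hence ij: "i < dim_col B" "j < dim_row A" by simp_all
  have "mat_adjoint (A * B) $$ (i, j) = cnj (\<Sum>k<dim_row B. A $$ (j, k) * B $$ (k, i))"
    using ij assms by (simp add: mat_mult_index_sum del: index_mult_mat(1))
  also have "\<dots> = (\<Sum>k<dim_row B. mat_adjoint B $$ (i, k) * mat_adjoint A $$ (k, j))"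
    unfolding cnj_sum using ij assms by (intro sum.cong refl) simp
  also have "\<dots> = (mat_adjoint B * mat_adjoint A) $$ (i, j)"
    using ij assms by (simp add: mat_mult_index_sum del: index_mult_mat(1))
  finally show "mat_adjoint (A * B) $$ (i, j) = (mat_adjoint B * mat_adjoint A) $$ (i, j)" .
qed simp_all

text \<open>The ring laws with equations between dimensions as side conditions: unlike the
  library versions, these can be discharged by the simplifier without guessing dimensions.\<close>

lemma mat_assoc:
  fixes A B C :: "'a :: comm_ring_1 mat"
  assumes "dim_col A = dim_row B" "dim_col B = dim_row C"
  shows "A * B * C = A * (B * C)"
  by (rule assoc_mult_mat[OF carrier_matI[OF refl assms(1)] carrier_matI[OF refl assms(2)] carrier_matI[OF refl refl]])

lemma mat_add_distrib:
  fixes A B C :: "'a :: comm_ring_1 mat"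
  assumes "dim_row A = dim_row B" "dim_col A = dim_col B" "dim_col A = dim_row C"
  shows "(A + B) * C = A * C + B * C"
  by (rule add_mult_distrib_mat[OF carrier_matI[OF assms(1) assms(2)] carrier_matI[OF refl refl] carrier_matI[OF assms(3)[symmetric, unfolded assms(2)] refl]])

lemma mat_distrib_add:
  fixes A B C :: "'a :: comm_ring_1 mat"
  assumes "dim_row B = dim_row C" "dim_col B = dim_col C" "dim_col A = dim_row B"
  shows "A * (B + C) = A * B + A * C"
  by (rule mult_add_distrib_mat[OF carrier_matI[OF refl assms(3)] carrier_matI[OF refl refl] carrier_matI[OF assms(1)[symmetric] assms(2)[symmetric]]])

lemma mat_minus_distrib:
  fixes A B C :: "'a :: comm_ring_1 mat"
  assumes "dim_row A = dim_row B" "dim_col A = dim_col B" "dim_col A = dim_row C"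
  shows "(A - B) * C = A * C - B * C"
  by (rule minus_mult_distrib_mat[OF carrier_matI[OF assms(1) assms(2)] carrier_matI[OF refl refl] carrier_matI[OF assms(3)[symmetric, unfolded assms(2)] refl]])

lemma mat_distrib_minus:
  fixes A B C :: "'a :: comm_ring_1 mat"
  assumes "dim_row B = dim_row C" "dim_col B = dim_col C" "dim_col A = dim_row B"
  shows "A * (B - C) = A * B - A * C"
  by (rule mult_minus_distrib_mat[OF carrier_matI[OF refl assms(3)] carrier_matI[OF refl refl] carrier_matI[OF assms(1)[symmetric] assms(2)[symmetric]]])

lemma mat_smult_left:
  fixes A B :: "'a :: comm_ring_1 mat"
  assumes "dim_col A = dim_row B"
  shows "(c \<cdot>\<^sub>m A) * B = c \<cdot>\<^sub>m (A * B)"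
  by (rule mult_smult_assoc_mat[OF carrier_matI[OF refl assms] carrier_matI[OF refl refl]])

lemma mat_smult_right:
  fixes A B :: "'a :: comm_ring_1 mat"
  assumes "dim_col A = dim_row B"
  shows "A * (c \<cdot>\<^sub>m B) = c \<cdot>\<^sub>m (A * B)"
  by (rule mult_smult_distrib[OF carrier_matI[OF refl assms] carrier_matI[OF refl refl]])

lemma mat_add_smult:
  fixes A B :: "'a :: comm_ring_1 mat"
  assumes "dim_row A = dim_row B" "dim_col A = dim_col B"
  shows "c \<cdot>\<^sub>m (A + B) = c \<cdot>\<^sub>m A + c \<cdot>\<^sub>m B"
  by (rule add_smult_distrib_left_mat[OF carrier_matI[OF assms] carrier_matI[OF refl refl]])

text \<open>Products are kept nested to the right, so an inverse pair stands in front of a remaining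
  factor; this is the shape in which simplification can cancel it.\<close>

lemma mat_cancel_left:
  fixes A B C :: "'a :: comm_ring_1 mat"
  assumes "A * B = 1\<^sub>m n" "dim_col A = dim_row B" "dim_col B = dim_row C"
  shows "A * (B * C) = C"
proof -
  from assms(1) have "dim_row A = n" "dim_col B = n" by (metis index_mult_mat(2,3) index_one_mat(2,3))+
  with assms show ?thesis by (simp flip: mat_assoc)
qed

subsection \<open>Traces\<close>

lemma mtrace_add: "dim_row A = dim_row B \<Longrightarrow> dim_col A = dim_row A \<Longrightarrow> dim_col B = dim_row B \<Longrightarrow>
    mtrace (A + B) = mtrace A + mtrace B"
  by (simp add: mtrace_def sum.distrib)

lemma mtrace_minus: "dim_row A = dim_row B \<Longrightarrow> dim_col A = dim_row A \<Longrightarrow> dim_col B = dim_row B \<Longrightarrow>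
    mtrace (A - B) = mtrace A - mtrace B"
  by (simp add: mtrace_def sum_subtractf)

lemma mtrace_smult: "dim_col A = dim_row A \<Longrightarrow> mtrace (c \<cdot>\<^sub>m A) = c * mtrace A"
  by (simp add: mtrace_def sum_distrib_left)

lemma mtrace_one [simp]: "mtrace (1\<^sub>m n) = of_nat n"
  by (simp add: mtrace_def)

lemma mtrace_mult_commute:
  assumes "dim_col A = dim_row B" "dim_col B = dim_row A"
  shows "mtrace (A * B) = mtrace (B * A)"
proof -
  have "mtrace (A * B) = (\<Sum>i<dim_row A. \<Sum>k<dim_row B. A $$ (i, k) * B $$ (k, i))"
    using assms by (simp add: mtrace_def mat_mult_index_sum del: index_mult_mat(1))
  also have "\<dots> = (\<Sum>k<dim_row B. \<Sum>i<dim_row A. B $$ (k, i) * A $$ (i, k))"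
    by (subst sum.swap) (simp add: mult.commute)
  also have "\<dots> = mtrace (B * A)"
    using assms by (simp add: mtrace_def mat_mult_index_sum del: index_mult_mat(1))
  finally show ?thesis .
qed

subsection \<open>Positive definite and semidefinite matrices\<close>

text \<open>The strict form is what the matrices under \<open>minv\<close> and \<open>logdet\<close>
  satisfy: it yields invertibility and a positive determinant.\<close>

definition hermitian_pd :: "nat \<Rightarrow> complex mat \<Rightarrow> bool" where
  "hermitian_pd n A \<longleftrightarrow> A \<in> carrier_mat n n \<and> mat_adjoint A = A \<and>
     (\<forall>x \<in> carrier_vec n. x \<noteq> 0\<^sub>v n \<longrightarrow> 0 < Re (conjugate x \<bullet> (A *\<^sub>v x)))"

lemma hermitian_psdD:
  assumes "hermitian_psd n A"
  shows "A \<in> carrier_mat n n" "dim_row A = n" "dim_col A = n" "mat_adjoint A = A"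
  using assms by (auto simp: hermitian_psd_def)

lemma hermitian_pdD:
  assumes "hermitian_pd n A"
  shows "A \<in> carrier_mat n n" "dim_row A = n" "dim_col A = n" "mat_adjoint A = A"
  using assms by (auto simp: hermitian_pd_def)

lemma hermitian_pd_imp_psd: "hermitian_pd n A \<Longrightarrow> hermitian_psd n A"
  unfolding hermitian_psd_def
proof (intro conjI ballI)
  assume A: "hermitian_pd n A"
  show "A \<in> carrier_mat n n" "mat_adjoint A = A" using A by (auto simp: hermitian_pd_def)
  fix x :: "complex vec" assume "x \<in> carrier_vec n"
  thus "0 \<le> Re (conjugate x \<bullet> (A *\<^sub>v x))"
    using A by (cases "x = 0\<^sub>v n") (auto simp: hermitian_pd_def intro: less_imp_le)
qed

lemma adjoint_scalar_prod:
  fixes B :: "complex mat"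
  assumes "x \<in> carrier_vec (dim_col B)" "y \<in> carrier_vec (dim_row B)"
  shows "conjugate x \<bullet> (mat_adjoint B *\<^sub>v y) = conjugate (B *\<^sub>v x) \<bullet> y"
proof -
  have "conjugate x \<bullet> (mat_adjoint B *\<^sub>v y)
      = (\<Sum>i<dim_col B. \<Sum>j<dim_row B. cnj (x $ i) * (cnj (B $$ (j, i)) * y $ j))"
    using assms by (simp add: scalar_prod_def lessThan_atLeast0 sum_distrib_left)
  also have "\<dots> = (\<Sum>j<dim_row B. \<Sum>i<dim_col B. cnj (x $ i) * (cnj (B $$ (j, i)) * y $ j))"
    by (rule sum.swap)
  also have "\<dots> = conjugate (B *\<^sub>v x) \<bullet> y"
    using assms by (simp add: scalar_prod_def lessThan_atLeast0 sum_distrib_left sum_distrib_right mult_ac)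
  finally show ?thesis .
qed

lemma congruence_scalar_prod:
  fixes A B :: "complex mat"
  assumes "A \<in> carrier_mat n n" "B \<in> carrier_mat n m" "x \<in> carrier_vec m"
  shows "conjugate x \<bullet> ((mat_adjoint B * A * B) *\<^sub>v x) = conjugate (B *\<^sub>v x) \<bullet> (A *\<^sub>v (B *\<^sub>v x))"
proof -
  have "(mat_adjoint B * A * B) *\<^sub>v x = mat_adjoint B *\<^sub>v (A *\<^sub>v (B *\<^sub>v x))"
    using assms by (simp add: assoc_mult_mat_vec[of _ m n _ m] assoc_mult_mat_vec[of _ m n _ n])
  thus ?thesis using assms by (simp add: adjoint_scalar_prod)
qed

lemma congruence_hermitian:
  fixes A B :: "complex mat"
  assumes "A \<in> carrier_mat n n" "B \<in> carrier_mat n m" "mat_adjoint A = A"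
  shows "mat_adjoint (mat_adjoint B * A * B) = mat_adjoint B * A * B"
  using assms by (simp add: mat_adjoint_mult mat_assoc)

lemma hermitian_psd_congruence:
  assumes "hermitian_psd n A" "B \<in> carrier_mat n m"
  shows "hermitian_psd m (mat_adjoint B * A * B)"
  unfolding hermitian_psd_def
proof (intro conjI ballI)
  note A = hermitian_psdD[OF assms(1)]
  show "mat_adjoint B * A * B \<in> carrier_mat m m" using A assms(2) by auto
  show "mat_adjoint (mat_adjoint B * A * B) = mat_adjoint B * A * B"
    using congruence_hermitian[OF A(1) assms(2) A(4)] .
  fix x :: "complex vec" assume x: "x \<in> carrier_vec m"
  show "0 \<le> Re (conjugate x \<bullet> ((mat_adjoint B * A * B) *\<^sub>v x))"
    unfolding congruence_scalar_prod[OF A(1) assms(2) x]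
    using assms x by (auto simp: hermitian_psd_def)
qed

text \<open>A nonzero determinant makes \<open>B\<close> injective, so nonzero vectors stay nonzero
  and strictness survives.\<close>

lemma hermitian_pd_congruence:
  assumes "hermitian_pd n A" "B \<in> carrier_mat n n" "det B \<noteq> 0"
  shows "hermitian_pd n (mat_adjoint B * A * B)"
  unfolding hermitian_pd_def
proof (intro conjI ballI impI)
  note A = hermitian_pdD[OF assms(1)]
  show "mat_adjoint B * A * B \<in> carrier_mat n n" using A assms(2) by auto
  show "mat_adjoint (mat_adjoint B * A * B) = mat_adjoint B * A * B"
    using congruence_hermitian[OF A(1) assms(2) A(4)] .
  fix x :: "complex vec" assume x: "x \<in> carrier_vec n" "x \<noteq> 0\<^sub>v n"
  have "B *\<^sub>v x \<noteq> 0\<^sub>v n"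
    using assms(2,3) x det_0_iff_vec_prod_zero[of B n] by blast
  thus "0 < Re (conjugate x \<bullet> ((mat_adjoint B * A * B) *\<^sub>v x))"
    unfolding congruence_scalar_prod[OF A(1) assms(2) x(1)]
    using assms x by (auto simp: hermitian_pd_def)
qed

lemma add_quadratic_form:
  fixes A B :: "complex mat"
  assumes "A \<in> carrier_mat n n" "B \<in> carrier_mat n n" "x \<in> carrier_vec n"
  shows "conjugate x \<bullet> ((A + B) *\<^sub>v x) = conjugate x \<bullet> (A *\<^sub>v x) + conjugate x \<bullet> (B *\<^sub>v x)"
  using assms
  by (subst add_mult_distrib_mat_vec) (auto intro!: scalar_prod_add_distrib[of _ n])

lemma hermitian_psd_add:
  "hermitian_psd n A \<Longrightarrow> hermitian_psd n B \<Longrightarrow> hermitian_psd n (A + B)"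
  by (auto simp: hermitian_psd_def add_quadratic_form mat_adjoint_add)

lemma hermitian_pd_add_psd:
  "hermitian_pd n A \<Longrightarrow> hermitian_psd n B \<Longrightarrow> hermitian_pd n (A + B)"
  by (auto simp: hermitian_psd_def hermitian_pd_def add_quadratic_form mat_adjoint_add
      intro!: add_pos_nonneg)

lemma smult_quadratic_form:
  fixes A :: "complex mat"
  assumes "A \<in> carrier_mat n n" "x \<in> carrier_vec n"
  shows "conjugate x \<bullet> ((c \<cdot>\<^sub>m A) *\<^sub>v x) = c * (conjugate x \<bullet> (A *\<^sub>v x))"
proof -
  have "(c \<cdot>\<^sub>m A) *\<^sub>v x = c \<cdot>\<^sub>v (A *\<^sub>v x)"
    using assms by (intro eq_vecI) auto
  thus ?thesis using assms by simp
qed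

lemma hermitian_psd_smult:
  "hermitian_psd n A \<Longrightarrow> 0 \<le> c \<Longrightarrow> hermitian_psd n (complex_of_real c \<cdot>\<^sub>m A)"
  by (auto simp: hermitian_psd_def smult_quadratic_form mat_adjoint_smult)

lemma hermitian_pd_smult:
  "hermitian_pd n A \<Longrightarrow> 0 < c \<Longrightarrow> hermitian_pd n (complex_of_real c \<cdot>\<^sub>m A)"
  by (auto simp: hermitian_pd_def smult_quadratic_form mat_adjoint_smult)

lemma hermitian_pd_one: "hermitian_pd n (1\<^sub>m n)"
  unfolding hermitian_pd_def
proof (intro conjI ballI impI)
  fix x :: "complex vec" assume x: "x \<in> carrier_vec n" "x \<noteq> 0\<^sub>v n"
  hence "0 < x \<bullet>c x" using conjugate_square_greater_0_vec[of x n] by simp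
  thus "0 < Re (conjugate x \<bullet> (1\<^sub>m n *\<^sub>v x))"
    using x by (simp add: less_complex_def comm_scalar_prod[of x n])
qed auto

text \<open>A nonzero kernel vector would make the quadratic form vanish.\<close>

lemma hermitian_pd_det_nonzero:
  assumes "hermitian_pd n A"
  shows "det A \<noteq> 0"
proof
  note A = hermitian_pdD[OF assms]
  assume "det A = 0"
  then obtain x where x: "x \<in> carrier_vec n" "x \<noteq> 0\<^sub>v n" "A *\<^sub>v x = 0\<^sub>v n"
    using det_0_iff_vec_prod_zero[OF A(1)] by blast
  have "0 < Re (conjugate x \<bullet> (A *\<^sub>v x))"
    using assms x(1,2) unfolding hermitian_pd_def by blast
  thus False using x by simp
qed

section \<open>Inverses of positive definite matrices\<close>

lemma minv_properties:
  assumes "A \<in> carrier_mat n n" "det A \<noteq> 0"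
  shows "minv A \<in> carrier_mat n n" "A * minv A = 1\<^sub>m n" "minv A * A = 1\<^sub>m n"
proof -
  \<comment> \<open>A nonzero determinant makes \<open>A\<close> a unit of the matrix ring, which
    supplies a witness for the choice in \<open>minv\<close>.\<close>
  obtain B where "inverts_mat B A" "inverts_mat A B" "B \<in> carrier_mat n n"
    using det_non_zero_imp_unit[OF assms, of "()"] assms(1)
    by (auto simp: Units_def ring_mat_def inverts_mat_def)
  hence "\<exists>B. B \<in> carrier_mat (dim_row A) (dim_row A) \<and> inverts_mat A B \<and> inverts_mat B A"
    using assms(1) by auto
  from someI_ex[OF this]
  show "minv A \<in> carrier_mat n n" "A * minv A = 1\<^sub>m n" "minv A * A = 1\<^sub>m n"
    using assms(1) by (auto simp: minv_def inverts_mat_def)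
qed

text \<open>For square matrices a right inverse is enough: the determinants multiply to 1, so
  \<open>A\<close> is invertible and \<open>minv A\<close> cancels. Explicit candidates for inverses
  are verified this way.\<close>

lemma minv_unique:
  assumes "A \<in> carrier_mat n n" "B \<in> carrier_mat n n" "A * B = 1\<^sub>m n"
  shows "minv A = B"
proof -
  have "det A * det B = 1" using det_mult[OF assms(1,2)] assms(3) by simp
  hence "det A \<noteq> 0" by auto
  note Ai = minv_properties[OF assms(1) this]
  have "minv A = minv A * (A * B)" using assms(3) Ai(1) by (metis right_mult_one_mat)
  also have "\<dots> = B"
    by (rule mat_cancel_left[OF Ai(3)]) (use assms Ai(1) in auto)
  finally show ?thesis .
qed

text \<open>The adjoint of \<open>minv A\<close> is again a right inverse of \<open>A\<close>, hence
  \<open>minv A\<close> is Hermitian; then \<open>minv A = minv A * A * minv A\<close> is a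
  congruence of \<open>A\<close>.\<close>

lemma hermitian_pd_minv:
  assumes "hermitian_pd n A"
  shows "hermitian_pd n (minv A)"
proof -
  note A = hermitian_pdD[OF assms]
  note Ai = minv_properties[OF A(1) hermitian_pd_det_nonzero[OF assms]]
  have "A * mat_adjoint (minv A) = mat_adjoint (minv A * A)"
    using A Ai(1) by (simp add: mat_adjoint_mult)
  hence herm: "mat_adjoint (minv A) = minv A"
    using A Ai by (intro minv_unique[symmetric, of _ n]) auto
  have "det (minv A) \<noteq> 0"
    using det_mult[OF A(1) Ai(1)] Ai(2) by auto
  from hermitian_pd_congruence[OF assms Ai(1) this]
  show ?thesis using A Ai herm by simp
qed

subsection \<open>Cholesky factorization\<close>

lemma hermitian_index:
  assumes "mat_adjoint A = A" "i < dim_row A" "j < dim_row A"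
  shows "cnj (A $$ (i, j)) = A $$ (j, i)"
proof -
  have "dim_col A = dim_row A" using assms(1) by (metis mat_adjoint_dim(1))
  hence "mat_adjoint A $$ (j, i) = cnj (A $$ (i, j))" using assms(2,3) by simp
  thus ?thesis using assms(1) by simp
qed

text \<open>A diagonal entry is the value of the quadratic form at a unit vector, and Hermitian
  symmetry makes it real.\<close>

lemma hermitian_psd_diag:
  assumes "hermitian_psd n A" "i < n"
  shows "A $$ (i, i) = complex_of_real (Re (A $$ (i, i)))" "0 \<le> Re (A $$ (i, i))"
proof -
  note A = hermitian_psdD[OF assms(1)]
  have "cnj (A $$ (i, i)) = A $$ (i, i)" using hermitian_index[of A i i] A assms(2) by simp
  thus "A $$ (i, i) = complex_of_real (Re (A $$ (i, i)))" by (simp add: complex_eq_iff)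
  have "conjugate (unit_vec n i) = (unit_vec n i :: complex vec)"
    by (rule eq_vecI) (auto simp: unit_vec_def)
  hence "conjugate (unit_vec n i) \<bullet> (A *\<^sub>v unit_vec n i) = A $$ (i, i)"
    using A assms(2) by (simp add: scalar_prod_left_unit scalar_prod_right_unit)
  moreover have "0 \<le> Re (conjugate (unit_vec n i) \<bullet> (A *\<^sub>v unit_vec n i))"
    using assms(1) unfolding hermitian_psd_def by (metis unit_vec_carrier)
  ultimately show "0 \<le> Re (A $$ (i, i))" by simp
qed

lemma hermitian_psd_trace:
  assumes "hermitian_psd n A"
  shows "0 \<le> Re (mtrace A)"
  using hermitian_psd_diag[OF assms] hermitian_psdD(2)[OF assms]
  by (auto simp: mtrace_def intro!: sum_nonneg)

text \<open>Congruence by \<open>1 - c e\<^sub>k e\<^sub>k\<^sup>* A\<close>; for \<open>c = 1 / A\<^sub>k\<^sub>k\<close> this is one step of Gaussian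
  elimination, and for \<open>A\<^sub>k\<^sub>k = 0\<close> a large \<open>c\<close> shows that the \<open>k\<close>-th column vanishes.\<close>

lemma hermitian_psd_peel:
  fixes c :: real
  assumes "hermitian_psd n A" "k < n"
  defines "d \<equiv> 2 * c - c\<^sup>2 * Re (A $$ (k, k))"
  shows "hermitian_psd n (mat n n (\<lambda>(i, j). A $$ (i, j) - complex_of_real d * A $$ (i, k) * A $$ (k, j)))"
proof -
  note A = hermitian_psdD[OF assms(1)]
  define P where "P = mat n n (\<lambda>(i, j). (if i = j then 1 else 0)
      - (if i = k then complex_of_real c * A $$ (k, j) else 0))"
  have P: "P \<in> carrier_mat n n" by (simp add: P_def)
  have AP: "(A * P) $$ (i, j) = A $$ (i, j) - c * A $$ (i, k) * A $$ (k, j)"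
    if "i < n" "j < n" for i j
  proof -
    have "(A * P) $$ (i, j) = (\<Sum>l<n. A $$ (i, l) * P $$ (l, j))"
      using that A P by (subst mat_mult_index_sum) auto
    also have "\<dots> = (\<Sum>l<n. (if l = j then A $$ (i, l) else 0)
        - (if l = k then A $$ (i, l) * (c * A $$ (k, j)) else 0))"
      using that by (intro sum.cong refl) (auto simp: P_def right_diff_distrib)
    finally show ?thesis using that assms(2) by (simp add: sum_subtractf mult_ac)
  qed
  \<comment> \<open>The two linear terms of the congruence contribute \<open>2 * c\<close>, the
    quadratic one \<open>c\<^sup>2\<close> times the pivot \<open>A $$ (k, k)\<close>; together they
    give \<open>d\<close>.\<close>
  have PAP: "(mat_adjoint P * A * P) $$ (i, j) = A $$ (i, j) - d * A $$ (i, k) * A $$ (k, j)"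
    if "i < n" "j < n" for i j
  proof -
    obtain r where ak: "A $$ (k, k) = complex_of_real r"
      using hermitian_psd_diag(1)[OF assms(1,2)] by blast
    have "(mat_adjoint P * (A * P)) $$ (i, j) = (\<Sum>l<n. mat_adjoint P $$ (i, l) * (A * P) $$ (l, j))"
      using that A P by (subst mat_mult_index_sum) auto
    also have "\<dots> = (\<Sum>l<n. (if l = i then (A * P) $$ (l, j) else 0)
        - (if l = k then c * A $$ (i, k) * (A * P) $$ (l, j) else 0))"
      using that P hermitian_index[of A k i] A assms(2)
      by (intro sum.cong refl) (auto simp: P_def left_diff_distrib)
    also have "\<dots> = (A * P) $$ (i, j) - c * A $$ (i, k) * (A * P) $$ (k, j)"
      using that assms(2) by (simp add: sum_subtractf)
    also have "\<dots> = A $$ (i, j) - d * A $$ (i, k) * A $$ (k, j)"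
      unfolding AP[OF that] AP[OF assms(2) that(2)] d_def ak Re_complex_of_real
      by (simp add: algebra_simps power2_eq_square)
    also have "mat_adjoint P * (A * P) = mat_adjoint P * A * P"
      using A P by (simp add: mat_assoc)
    finally show ?thesis .
  qed
  have "mat_adjoint P * A * P = mat n n (\<lambda>(i, j). A $$ (i, j) - complex_of_real d * A $$ (i, k) * A $$ (k, j))"
    using PAP P A by (intro eq_matI) (auto simp del: index_mult_mat(1))
  thus ?thesis using hermitian_psd_congruence[OF assms(1) P] by simp
qed

lemma hermitian_psd_zero_diag:
  assumes "hermitian_psd n A" "k < n" "A $$ (k, k) = 0" "i < n"
  shows "A $$ (i, k) = 0" "A $$ (k, i) = 0"
proof -
  note A = hermitian_psdD[OF assms(1)]
  have sym: "A $$ (k, i) = cnj (A $$ (i, k))" using hermitian_index[of A i k] A assms by simp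
  have le: "2 * c * (cmod (A $$ (i, k)))\<^sup>2 \<le> Re (A $$ (i, i))" for c :: real
  proof -
    have "0 \<le> Re (A $$ (i, i) - complex_of_real (2 * c) * A $$ (i, k) * A $$ (k, i))"
      using hermitian_psd_diag(2)[OF hermitian_psd_peel[OF assms(1,2), of c] assms(4)] assms(3,4)
      by simp
    also have "A $$ (i, i) - complex_of_real (2 * c) * A $$ (i, k) * A $$ (k, i)
        = A $$ (i, i) - complex_of_real (2 * c * (cmod (A $$ (i, k)))\<^sup>2)"
      unfolding sym by (simp add: complex_norm_square mult.assoc del: of_real_power)
    finally show ?thesis by simp
  qed
  show "A $$ (i, k) = 0"
  proof (rule ccontr)
    assume "A $$ (i, k) \<noteq> 0"
    hence pos: "0 < (cmod (A $$ (i, k)))\<^sup>2" by simp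
    \<comment> \<open>This \<open>c\<close> turns the left side of \<open>le\<close> into twice
      \<open>Re (A $$ (i, i)) + 1\<close>, which exceeds the right side.\<close>
    with le[of "(Re (A $$ (i, i)) + 1) / (cmod (A $$ (i, k)))\<^sup>2"] hermitian_psd_diag(2)[OF assms(1,4)]
    show False by simp
  qed
  thus "A $$ (k, i) = 0" using sym by simp
qed

text \<open>Induction downwards from \<open>k = n\<close>, where the matrix is zero; each step
  eliminates one pivot. The vanishing first \<open>k\<close> columns of the factor leave room for
  the columns still to be inserted, and the vanishing entries above the diagonal make it
  triangular.\<close>

lemma cholesky_partial:
  assumes "hermitian_psd n A" "k \<le> n" "\<And>i j. i < k \<Longrightarrow> j < n \<Longrightarrow> A $$ (i, j) = 0"
  shows "\<exists>C \<in> carrier_mat n n. A = C * mat_adjoint C \<and>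
    (\<forall>i j. i < j \<longrightarrow> j < n \<longrightarrow> C $$ (i, j) = 0) \<and> (\<forall>i<n. \<forall>j<k. C $$ (i, j) = 0)"
  using assms(2,1,3)
proof (induction k arbitrary: A rule: inc_induct)
  case base
  have "A = 0\<^sub>m n n" using hermitian_psdD[OF base(1)] base(2) by (intro eq_matI) auto
  thus ?case by (intro bexI[of _ "0\<^sub>m n n"]) (auto intro!: eq_matI simp: scalar_prod_def)
next
  case (step k)
  note A = hermitian_psdD[OF step.prems(1)]
  let ?a = "Re (A $$ (k, k))"
  have rows: "A $$ (i, k) = 0" if "i < k" for i using step that by simp
  show ?case
  proof (cases "?a = 0")
    case True
    \<comment> \<open>A zero pivot forces row \<open>k\<close> to vanish, so the induction
      hypothesis applies to \<open>A\<close> itself.\<close>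
    hence "A $$ (k, k) = 0" using hermitian_psd_diag(1)[OF step.prems(1) step.hyps(2)] by simp
    note z = hermitian_psd_zero_diag[OF step.prems(1) step.hyps(2) this]
    have "\<And>i j. i < Suc k \<Longrightarrow> j < n \<Longrightarrow> A $$ (i, j) = 0"
      using z step.prems(2) less_Suc_eq by auto
    from step.IH[OF step.prems(1) this] show ?thesis by (meson less_SucI)
  next
    case False
    with hermitian_psd_diag(2)[OF step.prems(1) step.hyps(2)] have a: "0 < ?a" by simp
    have ak: "A $$ (k, k) = complex_of_real ?a"
      using hermitian_psd_diag[OF step.prems(1) step.hyps(2)] by simp
    define A' where "A' = mat n n (\<lambda>(i, j). A $$ (i, j) - complex_of_real (1 / ?a) * A $$ (i, k) * A $$ (k, j))"
    \<comment> \<open>For \<open>c = 1 / ?a\<close> the coefficient of the peeling lemma collapses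
      to \<open>1 / ?a\<close>, exactly what clears row \<open>k\<close>.\<close>
    have "2 * (1 / ?a) - (1 / ?a)\<^sup>2 * ?a = 1 / ?a"
      using a by (simp add: power2_eq_square field_simps)
    with hermitian_psd_peel[OF step.prems(1) step.hyps(2), of "1 / ?a"]
    have psd: "hermitian_psd n A'" unfolding A'_def by (simp only:)
    have "A' $$ (i, j) = 0" if ij: "i < Suc k" "j < n" for i j
    proof (cases "i = k")
      case True
      have one: "complex_of_real (1 / ?a) * A $$ (k, k) = 1"
        using a by (subst (2) ak) (simp flip: of_real_mult)
      have "A' $$ (k, j) = A $$ (k, j) - complex_of_real (1 / ?a) * A $$ (k, k) * A $$ (k, j)"
        unfolding A'_def using step.hyps(2) ij by (simp only: index_mat prod.case)
      thus ?thesis unfolding True one by simp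
    next
      case False
      thus ?thesis using rows step.prems(2) step.hyps ij by (simp add: A'_def)
    qed
    from step.IH[OF psd this] obtain C where C: "C \<in> carrier_mat n n" "A' = C * mat_adjoint C"
      "\<And>i j. i < j \<Longrightarrow> j < n \<Longrightarrow> C $$ (i, j) = 0" "\<And>i j. i < n \<Longrightarrow> j < Suc k \<Longrightarrow> C $$ (i, j) = 0"
      by blast
    \<comment> \<open>The empty column \<open>k\<close> of \<open>C\<close> receives the pivot
      column over the square root of the pivot; its outer product with itself is what was subtracted
      from \<open>A\<close>.\<close>
    define D where "D = mat n n (\<lambda>(i, j). if j = k then A $$ (i, k) / complex_of_real (sqrt ?a) else C $$ (i, j))"
    have D: "D \<in> carrier_mat n n" by (simp add: D_def)
    have "A = D * mat_adjoint D"
    proof (rule eq_matI)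
      fix i j assume "i < dim_row (D * mat_adjoint D)" "j < dim_col (D * mat_adjoint D)"
      hence ij: "i < n" "j < n" using D by auto
      have sq: "complex_of_real (sqrt ?a) * complex_of_real (sqrt ?a) = complex_of_real ?a"
        using a by (simp flip: of_real_mult)
      have "(D * mat_adjoint D) $$ (i, j) = (\<Sum>l<n. D $$ (i, l) * cnj (D $$ (j, l)))"
        using ij D by (subst mat_mult_index_sum) auto
      also have "\<dots> = (\<Sum>l<n. (if l = k then A $$ (i, k) * A $$ (k, j) / complex_of_real ?a else 0)
          + C $$ (i, l) * cnj (C $$ (j, l)))"
        using ij C(4) hermitian_index[of A j k] A step.hyps sq
        by (intro sum.cong refl) (auto simp: D_def)
      also have "\<dots> = A $$ (i, k) * A $$ (k, j) / complex_of_real ?a + (C * mat_adjoint C) $$ (i, j)"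
        using ij C(1) step.hyps by (subst mat_mult_index_sum) (auto simp: sum.distrib)
      also have "\<dots> = A $$ (i, j)"
        unfolding C(2)[symmetric] using ij by (simp add: A'_def)
      finally show "A $$ (i, j) = (D * mat_adjoint D) $$ (i, j)" by simp
    qed (use A D in auto)
    moreover have "D $$ (i, j) = 0" if "i < j" "j < n" for i j
      using that C(3) rows by (auto simp: D_def)
    moreover have "D $$ (i, j) = 0" if "i < n" "j < k" for i j
      using that C(4) step.hyps by (auto simp: D_def)
    ultimately show ?thesis using D by blast
  qed
qed

lemma cholesky:
  assumes "hermitian_psd n A"
  obtains C where "C \<in> carrier_mat n n" "A = C * mat_adjoint C"
    "\<And>i j. i < j \<Longrightarrow> j < n \<Longrightarrow> C $$ (i, j) = 0"
  using cholesky_partial[OF assms, of 0] by auto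

text \<open>For a triangular factor \<open>C\<close> the determinant is the product of the squared
  moduli of its diagonal entries. Summing \<open>ln x \<le> x - 1\<close> over these gives the trace
  bound.\<close>

lemma hermitian_pd_det_bound:
  assumes "hermitian_pd n A"
  shows "det A = complex_of_real (Re (det A))" "0 < Re (det A)"
    "logdet A \<le> Re (mtrace A) - real n"
proof -
  obtain C where C: "C \<in> carrier_mat n n" "A = C * mat_adjoint C"
    and low: "\<And>i j. i < j \<Longrightarrow> j < n \<Longrightarrow> C $$ (i, j) = 0"
    using cholesky[OF hermitian_pd_imp_psd[OF assms]] by metis
  let ?p = "\<Prod>i<n. (cmod (C $$ (i, i)))\<^sup>2"
  have "det C = (\<Prod>i<n. C $$ (i, i))"
    using det_lower_triangular[OF low C(1)] C(1) by (simp add: prod_list_diag_prod lessThan_atLeast0)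
  moreover have "det (mat_adjoint C) = (\<Prod>i<n. cnj (C $$ (i, i)))"
  proof -
    have "upper_triangular (mat_adjoint C)"
      using low C(1) by (intro upper_triangularI) auto
    from det_upper_triangular[OF this, of n] show ?thesis
      using C(1) by (simp add: prod_list_diag_prod lessThan_atLeast0)
  qed
  ultimately have "det A = (\<Prod>i<n. C $$ (i, i)) * (\<Prod>i<n. cnj (C $$ (i, i)))"
    unfolding C(2) using C(1) by (subst det_mult[of _ n]) auto
  hence det: "det A = complex_of_real ?p"
    by (simp only: prod.distrib of_real_prod complex_norm_square)
  thus "det A = complex_of_real (Re (det A))" by simp
  have nz: "C $$ (i, i) \<noteq> 0" if "i < n" for i
    using hermitian_pd_det_nonzero[OF assms] that unfolding det by auto
  thus "0 < Re (det A)" unfolding det Re_complex_of_real by (auto intro!: prod_pos)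
  have "logdet A = (\<Sum>i<n. ln ((cmod (C $$ (i, i)))\<^sup>2))"
    unfolding logdet_def det Re_complex_of_real using nz by (subst ln_prod) auto
  also have "\<dots> \<le> (\<Sum>i<n. (cmod (C $$ (i, i)))\<^sup>2 - 1)"
    using nz by (intro sum_mono ln_le_minus_one) auto
  also have "\<dots> = (\<Sum>i<n. (cmod (C $$ (i, i)))\<^sup>2) - real n"
    by (simp add: sum_subtractf)
  \<comment> \<open>Adding the off-diagonal entries only enlarges the sum, and the full sum of
    squares is the trace of \<open>C * mat_adjoint C\<close>.\<close>
  also have "(\<Sum>i<n. (cmod (C $$ (i, i)))\<^sup>2) \<le> (\<Sum>i<n. \<Sum>j<n. (cmod (C $$ (i, j)))\<^sup>2)"
    by (intro sum_mono member_le_sum) auto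
  also have "\<dots> = (\<Sum>i<n. Re (A $$ (i, i)))"
  proof (intro sum.cong refl)
    fix i assume i: "i \<in> {..<n}"
    have "A $$ (i, i) = (\<Sum>j<n. C $$ (i, j) * cnj (C $$ (i, j)))"
      unfolding C(2) using i C(1) by (subst mat_mult_index_sum) auto
    also have "\<dots> = complex_of_real (\<Sum>j<n. (cmod (C $$ (i, j)))\<^sup>2)"
      by (simp add: complex_norm_square del: of_real_power)
    finally show "(\<Sum>j<n. (cmod (C $$ (i, j)))\<^sup>2) = Re (A $$ (i, i))" by simp
  qed
  also have "\<dots> = Re (mtrace A)"
    using C(1) unfolding C(2) by (simp add: mtrace_def)
  finally show "logdet A \<le> Re (mtrace A) - real n" by simp
qed

subsection \<open>Duality of log-determinants\<close>

text \<open>Sylvester's identity. Multiplying \<open>?F\<close> by either of two block triangular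
  matrices of determinant 1 makes it block triangular, and the two products display the two
  sides.\<close>

lemma det_one_add_mult_commute:
  fixes A B :: "complex mat"
  assumes A: "A \<in> carrier_mat n m" and B: "B \<in> carrier_mat m n"
  shows "det (1\<^sub>m n + A * B) = det (1\<^sub>m m + B * A)"
proof -
  let ?F = "four_block_mat (1\<^sub>m n) (- A) B (1\<^sub>m m)"
  have F: "?F \<in> carrier_mat (n + m) (n + m)" using A B by auto
  let ?U = "four_block_mat (1\<^sub>m n) A (0\<^sub>m m n) (1\<^sub>m m)"
  let ?V = "four_block_mat (1\<^sub>m n) (0\<^sub>m n m) (- B) (1\<^sub>m m)"
  have U: "?U \<in> carrier_mat (n + m) (n + m)" and V: "?V \<in> carrier_mat (n + m) (n + m)"
    using A B by auto
  have "?F * ?U = four_block_mat (1\<^sub>m n * 1\<^sub>m n + - A * 0\<^sub>m m n) (1\<^sub>m n * A + - A * 1\<^sub>m m)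
      (B * 1\<^sub>m n + 1\<^sub>m m * 0\<^sub>m m n) (B * A + 1\<^sub>m m * 1\<^sub>m m)"
    using A B by (intro mult_four_block_mat) auto
  also have "\<dots> = four_block_mat (1\<^sub>m n) (0\<^sub>m n m) B (1\<^sub>m m + B * A)"
    using A B by (intro cong_four_block_mat eq_matI) (auto simp: scalar_prod_def)
  finally have "det (?F * ?U) = det (1\<^sub>m m + B * A)"
    using A B by (simp add: det_four_block_mat_upper_right_zero[of _ n _ m])
  moreover have "det ?U = 1"
    using A by (subst det_four_block_mat_lower_left_zero[of _ n _ m]) auto
  ultimately have 1: "det ?F = det (1\<^sub>m m + B * A)"
    using det_mult[OF F U] by simp
  have "?F * ?V = four_block_mat (1\<^sub>m n * 1\<^sub>m n + - A * - B) (1\<^sub>m n * 0\<^sub>m n m + - A * 1\<^sub>m m)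
      (B * 1\<^sub>m n + 1\<^sub>m m * - B) (B * 0\<^sub>m n m + 1\<^sub>m m * 1\<^sub>m m)"
    using A B by (intro mult_four_block_mat) auto
  also have "\<dots> = four_block_mat (1\<^sub>m n + A * B) (- A) (0\<^sub>m m n) (1\<^sub>m m)"
    using A B by (intro cong_four_block_mat eq_matI) (auto simp: scalar_prod_def)
  finally have "det (?F * ?V) = det (1\<^sub>m n + A * B)"
    using A B by (simp add: det_four_block_mat_lower_left_zero[of _ n _ m])
  moreover have "det ?V = 1"
    using B by (subst det_four_block_mat_upper_right_zero[of _ n _ m]) auto
  ultimately have 2: "det ?F = det (1\<^sub>m n + A * B)"
    using det_mult[OF F V] by simp
  show ?thesis using 1 2 by simp
qed

lemma logdet_mult:
  assumes "hermitian_pd n A" "hermitian_pd m B" "det C = det A * det B"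
  shows "logdet C = logdet A + logdet B"
proof -
  have "det C = complex_of_real (Re (det A) * Re (det B))"
    unfolding assms(3) of_real_mult
    using hermitian_pd_det_bound(1)[OF assms(1)] hermitian_pd_det_bound(1)[OF assms(2)] by simp
  thus ?thesis unfolding logdet_def
    using hermitian_pd_det_bound(2)[OF assms(1)] hermitian_pd_det_bound(2)[OF assms(2)]
    by (simp add: ln_mult)
qed

lemma mat_eq_diffI:
  fixes A B :: "complex mat"
  shows "A + B = C \<Longrightarrow> dim_row A = dim_row B \<Longrightarrow> dim_col A = dim_col B \<Longrightarrow> B = C - A"
  by (intro eq_matI) auto

text \<open>A Cauchy--Schwarz inequality: the block columns \<open>P = (W^(-1/2), \<Omega>^(1/2) C)\<close> and
  \<open>Q = (W^(1/2), \<Omega>^(-1/2) Y)\<close> satisfy \<open>P\<^sup>*Q = W\<close>, and the matrix below is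
  \<open>P\<^sup>*P - P\<^sup>*Q (Q\<^sup>*Q)^(-1) Q\<^sup>*P\<close>.\<close>

lemma schur_complement_psd:
  assumes W: "hermitian_pd m W" and Om: "hermitian_pd k \<Omega>"
    and C: "C \<in> carrier_mat k m" and Y: "Y \<in> carrier_mat k m"
    and CY: "1\<^sub>m m + mat_adjoint C * Y = W"
  defines "M \<equiv> W + mat_adjoint Y * minv \<Omega> * Y"
  shows "hermitian_psd m (minv W + mat_adjoint C * \<Omega> * C - W * minv M * W)"
proof -
  note Wd = hermitian_pdD[OF W] and Od = hermitian_pdD[OF Om]
  note Wi = minv_properties[OF Wd(1) hermitian_pd_det_nonzero[OF W]]
  note Oi = minv_properties[OF Od(1) hermitian_pd_det_nonzero[OF Om]]
  note Wid = hermitian_pdD[OF hermitian_pd_minv[OF W]] and Oid = hermitian_pdD[OF hermitian_pd_minv[OF Om]]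
  have M: "hermitian_pd m M" unfolding M_def
    by (intro hermitian_pd_add_psd W hermitian_psd_congruence[OF hermitian_pd_imp_psd Y] hermitian_pd_minv Om)
  note Md = hermitian_pdD[OF M]
  note Mi = minv_properties[OF Md(1) hermitian_pd_det_nonzero[OF M]]
  note Mid = hermitian_pdD[OF hermitian_pd_minv[OF M]]
  have dims: "dim_row C = k" "dim_col C = m" "dim_row Y = k" "dim_col Y = m" using C Y by auto
  let ?Mi = "minv M" and ?Wi = "minv W" and ?Oi = "minv \<Omega>"
  \<comment> \<open>Up to the factors \<open>W^(1/2)\<close> and \<open>\<Omega>^(1/2)\<close>,
    these are the two blocks of the residual after projecting the first block column onto the
    second. Weighting the Gram products by \<open>W\<close> and \<open>\<Omega>\<close> avoids the
    square roots.\<close>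
  let ?P = "?Wi - ?Mi * W" and ?Q = "C - ?Oi * (Y * (?Mi * W))"
  note d = dims Wd(2-4) Od(2-4) Wid(2-4) Oid(2-4) Mid(2-4) Md(2-4)
  have CY': "mat_adjoint C * Y = W - 1\<^sub>m m"
    by (rule mat_eq_diffI[OF CY]) (use dims in auto)
  have YC': "mat_adjoint Y * C = W - 1\<^sub>m m"
  proof -
    have "mat_adjoint Y * C = mat_adjoint (mat_adjoint C * Y)" using dims by (simp add: mat_adjoint_mult)
    thus ?thesis unfolding CY' using d by (simp add: mat_adjoint_minus)
  qed
  \<comment> \<open>\<open>C1\<close> and \<open>M1\<close> eliminate \<open>C\<close> against
    \<open>Y\<close> and \<open>\<Omega>\<close> against \<open>Y\<close>. The trailing factor
    \<open>X\<close> lets them rewrite inside products nested to the right.\<close>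
  have C1: "mat_adjoint C * (Y * X) = W * X - X" if "dim_row X = m" for X
  proof -
    have "mat_adjoint C * (Y * X) = (mat_adjoint C * Y) * X" using that d by (simp add: mat_assoc)
    thus ?thesis unfolding CY' using that d by (simp add: mat_minus_distrib)
  qed
  have M1: "mat_adjoint Y * (?Oi * (Y * X)) = M * X - W * X" if "dim_row X = m" for X
  proof -
    have "M * X = W * X + mat_adjoint Y * (?Oi * (Y * X))"
      unfolding M_def using that d by (simp add: mat_assoc mat_add_distrib)
    thus ?thesis using that d by (intro mat_eq_diffI[OF sym]) auto
  qed
  note cancel = mat_cancel_left[OF Wi(2)] mat_cancel_left[OF Wi(3)] mat_cancel_left[OF Oi(2)]
    mat_cancel_left[OF Oi(3)] mat_cancel_left[OF Mi(2)] mat_cancel_left[OF Mi(3)]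
  note ring = mat_assoc mat_minus_distrib mat_distrib_minus cancel Wi(2,3) Oi(2,3) Mi(2,3)
  have eP: "mat_adjoint ?P * W * ?P = ?Wi - W * ?Mi - (?Mi * W - W * (?Mi * (W * (?Mi * W))))"
    using d by (simp add: mat_adjoint_minus mat_adjoint_mult ring)
  have eQ: "mat_adjoint ?Q * \<Omega> * ?Q = mat_adjoint C * (\<Omega> * C) - (W * (?Mi * W) - W * ?Mi)
     - (W * (?Mi * W) - ?Mi * W - (W * (?Mi * W) - W * (?Mi * (W * (?Mi * W)))))"
    using d by (simp add: mat_adjoint_minus mat_adjoint_mult ring C1 M1 YC')
  have "mat_adjoint ?P * W * ?P + mat_adjoint ?Q * \<Omega> * ?Q
      = ?Wi + mat_adjoint C * \<Omega> * C - W * ?Mi * W"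
  proof -
    \<comment> \<open>After expansion only six distinct products remain, and the rest is
      cancellation of summands.\<close>
    have key: "p - q - (r - s) + (t - (u - q) - (u - r - (u - s))) = p + t - u"
      if "p \<in> carrier_mat m m" "q \<in> carrier_mat m m" "r \<in> carrier_mat m m"
        "s \<in> carrier_mat m m" "t \<in> carrier_mat m m" "u \<in> carrier_mat m m"
      for p q r s t u :: "complex mat"
      using that by (intro eq_matI) auto
    have eqs: "mat_adjoint C * \<Omega> * C = mat_adjoint C * (\<Omega> * C)" "W * ?Mi * W = W * (?Mi * W)"
      by (simp_all add: mat_assoc d)
    show ?thesis unfolding eP eQ eqs by (rule key; rule carrier_matI; simp add: d)
  qed
  moreover have "hermitian_psd m (mat_adjoint ?P * W * ?P)" "hermitian_psd m (mat_adjoint ?Q * \<Omega> * ?Q)"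
    by (rule hermitian_psd_congruence[OF hermitian_pd_imp_psd[OF W]], rule carrier_matI; simp add: d)
      (rule hermitian_psd_congruence[OF hermitian_pd_imp_psd[OF Om]], rule carrier_matI; simp add: d)
  hence "hermitian_psd m (mat_adjoint ?P * W * ?P + mat_adjoint ?Q * \<Omega> * ?Q)"
    by (rule hermitian_psd_add)
  ultimately show ?thesis by (simp only:)
qed

text \<open>Turns a determinant identity between four positive definite matrices into a linear
  relation without any division.\<close>

lemma logdet_mult_cross:
  assumes "hermitian_pd n A" "hermitian_pd m B" "hermitian_pd k C" "hermitian_pd l D"
    and "det A * det B = det C * det D"
  shows "logdet A + logdet B = logdet C + logdet D"
proof -
  note bounds = hermitian_pd_det_bound[OF assms(1)] hermitian_pd_det_bound[OF assms(2)]
    hermitian_pd_det_bound[OF assms(3)] hermitian_pd_det_bound[OF assms(4)]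
  have "complex_of_real (Re (det A) * Re (det B)) = complex_of_real (Re (det C) * Re (det D))"
    unfolding of_real_mult using assms(5) bounds(1,4,7,10) by simp
  hence "Re (det A) * Re (det B) = Re (det C) * Re (det D)" by (simp only: of_real_eq_iff)
  hence "ln (Re (det A) * Re (det B)) = ln (Re (det C) * Re (det D))" by simp
  thus ?thesis using bounds(2,5,8,11) by (simp add: logdet_def ln_mult)
qed

lemma logdet_smult:
  assumes "hermitian_pd n A" "0 < c"
  shows "logdet (complex_of_real c \<cdot>\<^sub>m A) = real n * ln c + logdet A"
proof -
  have "Re (det (complex_of_real c \<cdot>\<^sub>m A)) = c ^ n * Re (det A)"
    using hermitian_pdD[OF assms(1)] by (simp flip: of_real_power)
  thus ?thesis
    using hermitian_pd_det_bound(2)[OF assms(1)] assms(2) by (simp add: logdet_def ln_mult ln_realpow)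
qed

section \<open>Additive updates: determinant lemma and Woodbury identity\<close>

lemma det_add_mult:
  fixes T A B :: "complex mat"
  assumes T: "T \<in> carrier_mat n n" "det T \<noteq> 0" and A: "A \<in> carrier_mat n m" and B: "B \<in> carrier_mat m n"
  shows "det (T + A * B) = det T * det (1\<^sub>m m + B * (minv T * A))"
proof -
  note Ti = minv_properties[OF T]
  \<comment> \<open>Pulling \<open>T\<close> out on the left leaves the identity plus a product, to
    which Sylvester's identity applies.\<close>
  have "T + A * B = T * (1\<^sub>m n + (minv T * A) * B)"
    using T(1) A B Ti(1) by (simp add: mat_distrib_add mat_assoc mat_cancel_left[OF Ti(2)])
  hence "det (T + A * B) = det T * det (1\<^sub>m n + (minv T * A) * B)"
    using T(1) A B Ti(1) by (simp add: det_mult[of _ n])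
  also have "det (1\<^sub>m n + (minv T * A) * B) = det (1\<^sub>m m + B * (minv T * A))"
    using T(1) A B Ti(1) by (intro det_one_add_mult_commute) auto
  finally show ?thesis .
qed

context
  fixes n m :: nat and \<Theta> B W :: "complex mat"
  assumes Th: "hermitian_pd n \<Theta>" and B: "B \<in> carrier_mat m n"
  defines "W \<equiv> 1\<^sub>m m + B * minv \<Theta> * mat_adjoint B"
begin

lemma woodbury_pd: "hermitian_pd m W"
proof -
  have "hermitian_psd m (mat_adjoint (mat_adjoint B) * minv \<Theta> * mat_adjoint B)"
    using B by (intro hermitian_psd_congruence[OF hermitian_pd_imp_psd[OF hermitian_pd_minv[OF Th]]]) auto
  thus ?thesis unfolding W_def by (intro hermitian_pd_add_psd hermitian_pd_one) simp
qed

lemma woodbury_det: "det (\<Theta> + mat_adjoint B * B) = det \<Theta> * det W"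
proof -
  note T = hermitian_pdD[OF Th]
  note Ti = minv_properties[OF T(1) hermitian_pd_det_nonzero[OF Th]]
  have "det (\<Theta> + mat_adjoint B * B) = det \<Theta> * det (1\<^sub>m m + B * (minv \<Theta> * mat_adjoint B))"
    using B by (intro det_add_mult[OF T(1) hermitian_pd_det_nonzero[OF Th]]) auto
  thus ?thesis using B T(2,3) Ti(1) by (simp add: W_def mat_assoc)
qed

text \<open>Woodbury's formula, verified by multiplying out the candidate inverse. Stated as a
  difference, it displays the covariance update as a congruence of \<open>minv W\<close>.\<close>

lemma woodbury_minv:
  "minv \<Theta> - minv (\<Theta> + mat_adjoint B * B) = minv \<Theta> * mat_adjoint B * minv W * B * minv \<Theta>"
proof -
  note T = hermitian_pdD[OF Th] and Wd = hermitian_pdD[OF woodbury_pd]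
  note Ti = minv_properties[OF T(1) hermitian_pd_det_nonzero[OF Th]]
  note Wi = minv_properties[OF Wd(1) hermitian_pd_det_nonzero[OF woodbury_pd]]
  note d = T(2,3) Wd(2,3) carrier_matD[OF Ti(1)] carrier_matD[OF Wi(1)] carrier_matD[OF B]
  let ?p = "mat_adjoint B * (B * minv \<Theta>)" and ?q = "mat_adjoint B * (minv W * (B * minv \<Theta>))"
  let ?X = "minv \<Theta> * (mat_adjoint B * (minv W * (B * minv \<Theta>)))"
  have N: "B * (minv \<Theta> * (mat_adjoint B * X)) = W * X - X" if "dim_row X = m" for X
  proof -
    have "X + B * (minv \<Theta> * (mat_adjoint B * X)) = W * X"
      unfolding W_def using that by (simp add: d mat_assoc mat_add_distrib)
    thus ?thesis using that by (intro mat_eq_diffI) (simp_all add: d)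
  qed
  have "(\<Theta> + mat_adjoint B * B) * (minv \<Theta> - ?X) = 1\<^sub>m n + ?p - (?q + (?p - ?q))"
    by (simp add: d N mat_assoc mat_add_distrib mat_distrib_minus Ti(2,3)
        mat_cancel_left[OF Ti(2)] mat_cancel_left[OF Wi(2)])
  also have "\<dots> = 1\<^sub>m n" by (rule eq_matI) (simp_all add: d del: index_mult_mat(1))
  finally have "minv (\<Theta> + mat_adjoint B * B) = minv \<Theta> - ?X"
    by (intro minv_unique[of _ n]) (auto intro!: carrier_matI simp: d)
  moreover have "minv \<Theta> - (minv \<Theta> - ?X) = ?X"
    by (rule eq_matI) (simp_all add: d del: index_mult_mat(1))
  ultimately show ?thesis by (simp add: d mat_assoc)
qed

end

section \<open>The inequality for a single link\<close>

lemma congruence_factor: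
  fixes C H :: "complex mat"
  assumes "C \<in> carrier_mat m m" "H \<in> carrier_mat m n"
  shows "mat_adjoint H * (C * mat_adjoint C) * H = mat_adjoint (mat_adjoint C * H) * (mat_adjoint C * H)"
  using carrier_matD[OF assms(1)] carrier_matD[OF assms(2)]
  by (simp add: mat_adjoint_mult mat_assoc)

text \<open>With \<open>\<Lambda>\<close> factored, Woodbury's formula writes the difference as a
  congruence of the positive definite \<open>minv W\<close>. This keeps the iterates positive
  semidefinite.\<close>

lemma hermitian_psd_minv_diff:
  assumes Th: "hermitian_pd n \<Theta>" and La: "hermitian_psd m \<Lambda>" and H: "H \<in> carrier_mat m n"
  shows "hermitian_psd n (minv \<Theta> - minv (\<Theta> + mat_adjoint H * \<Lambda> * H))"
proof -
  obtain C where C: "C \<in> carrier_mat m m" "\<Lambda> = C * mat_adjoint C"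
    using cholesky[OF La] by metis
  define B where "B = mat_adjoint C * H"
  have B: "B \<in> carrier_mat m n" using C(1) H by (simp add: B_def)
  define W where "W = 1\<^sub>m m + B * minv \<Theta> * mat_adjoint B"
  note W = woodbury_pd[OF Th B, folded W_def]
  note Ti = hermitian_pdD[OF hermitian_pd_minv[OF Th]] and Wi = hermitian_pdD[OF hermitian_pd_minv[OF W]]
  note d = carrier_matD[OF B] Ti(2-4) Wi(2-4)
  have "hermitian_psd n (mat_adjoint (B * minv \<Theta>) * minv W * (B * minv \<Theta>))"
    using hermitian_pd_imp_psd[OF hermitian_pd_minv[OF W]]
    by (rule hermitian_psd_congruence) (rule mult_carrier_mat[OF B Ti(1)])
  also have "mat_adjoint (B * minv \<Theta>) * minv W * (B * minv \<Theta>) = minv \<Theta> * mat_adjoint B * minv W * B * minv \<Theta>"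
    by (simp add: d mat_adjoint_mult mat_assoc)
  also have "\<dots> = minv \<Theta> - minv (\<Theta> + mat_adjoint B * B)"
    using woodbury_minv[OF Th B] by (simp add: W_def)
  finally show ?thesis
    unfolding C(2) congruence_factor[OF C(1) H] B_def .
qed

text \<open>The left side is \<open>ln |W|\<close> and the difference of log-determinants on the
  right is \<open>ln |M| - ln |W|\<close>. With \<open>X = W * minv M * W\<close> the claim becomes
  \<open>ln |X| \<le> Tr \<Lambda>\<Omega> - Tr \<Theta>S\<close>, where
  \<open>Tr \<Theta>S = m - Tr (minv W)\<close>. The Schur complement bounds \<open>Tr X\<close> by
  \<open>Tr (minv W) + Tr \<Lambda>\<Omega>\<close>.\<close>

lemma logdet_duality:
  assumes Th: "hermitian_pd n \<Theta>" and Om: "hermitian_pd m \<Omega>" and La: "hermitian_psd m \<Lambda>"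
    and H: "H \<in> carrier_mat m n"
  defines "S \<equiv> minv \<Theta> - minv (\<Theta> + mat_adjoint H * \<Lambda> * H)"
  shows "logdet (\<Theta> + mat_adjoint H * \<Lambda> * H) - logdet \<Theta>
    \<le> logdet (\<Omega> + H * S * mat_adjoint H) - logdet \<Omega> + Re (mtrace (\<Lambda> * \<Omega>)) - Re (mtrace (\<Theta> * S))"
proof -
  obtain C where C: "C \<in> carrier_mat m m" "\<Lambda> = C * mat_adjoint C"
    using cholesky[OF La] by metis
  define B where "B = mat_adjoint C * H"
  have B: "B \<in> carrier_mat m n" using C(1) H by (simp add: B_def)
  define W where "W = 1\<^sub>m m + B * minv \<Theta> * mat_adjoint B"
  \<comment> \<open>Chosen so that the received covariance is
    \<open>Y * minv W * mat_adjoint Y\<close> while \<open>mat_adjoint C * Y\<close> equals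
    \<open>W\<close> minus the identity.\<close>
  define Y where "Y = H * minv \<Theta> * mat_adjoint B"
  define M where "M = W + mat_adjoint Y * minv \<Omega> * Y"
  note W = woodbury_pd[OF Th B, folded W_def]
  note Td = hermitian_pdD[OF Th] and Wd = hermitian_pdD[OF W] and Od = hermitian_pdD[OF Om]
  note Tid = hermitian_pdD[OF hermitian_pd_minv[OF Th]] and Wid = hermitian_pdD[OF hermitian_pd_minv[OF W]]
    and Oid = hermitian_pdD[OF hermitian_pd_minv[OF Om]]
  note Ti = minv_properties[OF Td(1) hermitian_pd_det_nonzero[OF Th]]
  note Wi = minv_properties[OF Wd(1) hermitian_pd_det_nonzero[OF W]]
  have Y: "Y \<in> carrier_mat m m" unfolding Y_def
    by (intro mult_carrier_mat[OF mult_carrier_mat[OF H Tid(1)]]) (simp add: B)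
  note d = carrier_matD[OF C(1)] carrier_matD[OF B] carrier_matD[OF H] carrier_matD[OF Y]
    Td(2-4) Wd(2-4) Od(2-4) Tid(2-4) Wid(2-4) Oid(2-4)
  have M: "hermitian_pd m M" unfolding M_def
    by (intro hermitian_pd_add_psd W hermitian_psd_congruence[OF hermitian_pd_imp_psd Y] hermitian_pd_minv Om)
  have HLH: "mat_adjoint H * \<Lambda> * H = mat_adjoint B * B"
    unfolding C(2) congruence_factor[OF C(1) H] B_def ..
  have S: "S = minv \<Theta> * mat_adjoint B * minv W * B * minv \<Theta>"
    unfolding S_def HLH W_def by (rule woodbury_minv[OF Th B])
  have HSH: "H * S * mat_adjoint H = Y * minv W * mat_adjoint Y"
    unfolding S Y_def by (simp add: d mat_assoc mat_adjoint_mult)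
  have dual: "logdet (\<Theta> + mat_adjoint B * B) = logdet \<Theta> + logdet W"
    using woodbury_det[OF Th B] by (intro logdet_mult[OF Th W]) (simp add: W_def)
  have pdOm': "hermitian_pd m (\<Omega> + Y * minv W * mat_adjoint Y)"
  proof (rule hermitian_pd_add_psd[OF Om])
    have "hermitian_psd m (mat_adjoint (mat_adjoint Y) * minv W * mat_adjoint Y)"
      using Y by (intro hermitian_psd_congruence[OF hermitian_pd_imp_psd[OF hermitian_pd_minv[OF W]]]) simp
    thus "hermitian_psd m (Y * minv W * mat_adjoint Y)" by simp
  qed
  \<comment> \<open>The determinant lemma at \<open>\<Omega>\<close> and at \<open>W\<close> leaves
    second factors that agree by Sylvester's identity; this relates the primal determinant to
    \<open>M\<close>.\<close>
  have "det (\<Omega> + Y * (minv W * mat_adjoint Y)) = det \<Omega> * det (1\<^sub>m m + minv W * mat_adjoint Y * (minv \<Omega> * Y))"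
    using det_add_mult[OF Od(1) hermitian_pd_det_nonzero[OF Om] Y, of "minv W * mat_adjoint Y"]
      mult_carrier_mat[OF Wid(1), of "mat_adjoint Y" m] Y by simp
  moreover have "det (W + mat_adjoint Y * (minv \<Omega> * Y)) = det W * det (1\<^sub>m m + minv \<Omega> * Y * (minv W * mat_adjoint Y))"
    using det_add_mult[OF Wd(1) hermitian_pd_det_nonzero[OF W], of "mat_adjoint Y" m "minv \<Omega> * Y"]
      mult_carrier_mat[OF Oid(1) Y] Y by simp
  moreover have "det (1\<^sub>m m + minv \<Omega> * Y * (minv W * mat_adjoint Y)) = det (1\<^sub>m m + minv W * mat_adjoint Y * (minv \<Omega> * Y))"
    using Y by (intro det_one_add_mult_commute[of _ m m] mult_carrier_mat[OF Oid(1)] mult_carrier_mat[OF Wid(1)]) simp_all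
  ultimately have primal: "logdet (\<Omega> + Y * minv W * mat_adjoint Y) + logdet W = logdet \<Omega> + logdet M"
    by (intro logdet_mult_cross[OF pdOm' W Om M]) (simp add: M_def mat_assoc d)
  define X where "X = W * minv M * W"
  have "hermitian_pd m (mat_adjoint W * minv M * W)"
    by (intro hermitian_pd_congruence hermitian_pd_minv M Wd(1) hermitian_pd_det_nonzero[OF W])
  hence X: "hermitian_pd m X" by (simp add: X_def d)
  note Xd = hermitian_pdD[OF X]
  note Mi = minv_properties[OF hermitian_pdD(1)[OF M] hermitian_pd_det_nonzero[OF M]]
  have "det M * det (minv M) = 1"
    using det_mult[OF hermitian_pdD(1)[OF M] Mi(1)] Mi(2) by simp
  moreover have "det X = det W * det (minv M) * det W"
    unfolding X_def using Wd(1) Mi(1) by (simp add: det_mult[of _ m] mult_carrier_mat)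
  ultimately have MX: "logdet M + logdet X = logdet W + logdet W"
    by (intro logdet_mult_cross[OF M X W W]) (simp add: mult_ac)
  have CY: "1\<^sub>m m + mat_adjoint C * Y = W"
    unfolding Y_def W_def B_def by (simp add: d mat_assoc)
  have "hermitian_psd m (minv W + mat_adjoint C * \<Omega> * C - X)"
    using schur_complement_psd[OF W Om C(1) Y CY] by (simp add: X_def M_def)
  hence "Re (mtrace X) \<le> Re (mtrace (minv W)) + Re (mtrace (mat_adjoint C * \<Omega> * C))"
    using hermitian_psd_trace[of m] by (fastforce simp: d Xd mtrace_add mtrace_minus)
  moreover have "mtrace (mat_adjoint C * \<Omega> * C) = mtrace (\<Lambda> * \<Omega>)"
    using mtrace_mult_commute[of "mat_adjoint C * \<Omega>" C] by (simp add: d C(2) mat_assoc)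
  moreover have "mtrace (\<Theta> * S) = of_nat m - mtrace (minv W)"
  proof -
    have N: "B * (minv \<Theta> * mat_adjoint B) = W - 1\<^sub>m m"
      by (rule mat_eq_diffI[of "1\<^sub>m m"]) (simp_all add: W_def d mat_assoc)
    have "mtrace (\<Theta> * S) = mtrace (mat_adjoint B * (minv W * B * minv \<Theta>))"
      unfolding S by (simp add: d mat_assoc mat_cancel_left[OF Ti(2)])
    also have "\<dots> = mtrace (minv W * (B * (minv \<Theta> * mat_adjoint B)))"
      by (subst mtrace_mult_commute) (simp_all add: d mat_assoc)
    also have "\<dots> = of_nat m - mtrace (minv W)"
      unfolding N by (simp add: d mat_distrib_minus Wi(3) mtrace_minus)
    finally show ?thesis .
  qed
  ultimately show ?thesis
    unfolding HLH HSH dual using hermitian_pd_det_bound(3)[OF X] primal MX by simp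
qed

text \<open>Apply the unscaled inequality with \<open>\<Omega>\<close> divided by \<open>c\<close>.
  Both log-determinants on the primal side then shift by the same amount, which cancels in their
  difference; multiplying by \<open>c\<close> clears the traces.\<close>

lemma logdet_duality_scaled:
  assumes Th: "hermitian_pd n \<Theta>" and Om: "hermitian_pd m \<Omega>" and La: "hermitian_psd m \<Lambda>"
    and H: "H \<in> carrier_mat m n" and c: "0 < c"
  defines "S \<equiv> complex_of_real c \<cdot>\<^sub>m (minv \<Theta> - minv (\<Theta> + mat_adjoint H * \<Lambda> * H))"
  shows "c * (logdet (\<Theta> + mat_adjoint H * \<Lambda> * H) - logdet \<Theta>)
    \<le> c * (logdet (\<Omega> + H * S * mat_adjoint H) - logdet \<Omega>) + Re (mtrace (\<Lambda> * \<Omega>)) - Re (mtrace (\<Theta> * S))"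
proof -
  let ?S = "minv \<Theta> - minv (\<Theta> + mat_adjoint H * \<Lambda> * H)"
  let ?c = "complex_of_real (1 / c)"
  note psd = hermitian_psd_minv_diff[OF Th La H]
  note d = hermitian_psdD(2,3)[OF psd] carrier_matD[OF H] hermitian_psdD(2,3)[OF La]
    hermitian_pdD(2,3)[OF Om] hermitian_pdD(2,3)[OF Th]
  have S: "?S = ?c \<cdot>\<^sub>m S"
    unfolding S_def using c by (intro eq_matI) simp_all
  have Sd: "dim_row S = n" "dim_col S = n" by (simp_all add: S_def d del: minus_mat_def index_minus_mat)
  have "hermitian_psd m (mat_adjoint (mat_adjoint H) * S * mat_adjoint H)"
    unfolding S_def using H c psd by (intro hermitian_psd_congruence hermitian_psd_smult) auto
  hence pd: "hermitian_pd m (\<Omega> + H * S * mat_adjoint H)"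
    using Om by (intro hermitian_pd_add_psd) simp_all
  have "?c \<cdot>\<^sub>m \<Omega> + H * ?S * mat_adjoint H = ?c \<cdot>\<^sub>m (\<Omega> + H * S * mat_adjoint H)"
    unfolding S by (simp add: Sd d mat_smult_left mat_smult_right mat_add_smult)
  moreover have "mtrace (\<Lambda> * (?c \<cdot>\<^sub>m \<Omega>)) = ?c * mtrace (\<Lambda> * \<Omega>)" "mtrace (\<Theta> * ?S) = ?c * mtrace (\<Theta> * S)"
    unfolding S by (simp_all add: Sd d mat_smult_right mtrace_smult)
  moreover have "hermitian_pd m (?c \<cdot>\<^sub>m \<Omega>)"
    using c by (intro hermitian_pd_smult Om) simp
  ultimately have "logdet (\<Theta> + mat_adjoint H * \<Lambda> * H) - logdet \<Theta>
      \<le> logdet (\<Omega> + H * S * mat_adjoint H) - logdet \<Omega> + (Re (mtrace (\<Lambda> * \<Omega>)) - Re (mtrace (\<Theta> * S))) / c"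
    using logdet_duality[OF Th _ La H, of "?c \<cdot>\<^sub>m \<Omega>"] logdet_smult[OF pd, of "1 / c"] logdet_smult[OF Om, of "1 / c"] c
    by (simp add: diff_divide_distrib)
  from mult_left_mono[OF this, of c] show ?thesis using c by (simp add: algebra_simps diff_divide_distrib)
qed

subsection \<open>The dual link iteration\<close>

text \<open>The reversed network, in which transmitters and receivers change roles. Reverse
  quantities become forward ones, so one lemma covers both halves of an iteration.\<close>

definition adjoint_channel :: "(nat \<Rightarrow> nat \<Rightarrow> complex mat) \<Rightarrow> nat \<Rightarrow> nat \<Rightarrow> complex mat" where
  "adjoint_channel H l k = mat_adjoint (H k l)"

lemma adjoint_channel_twice [simp]: "adjoint_channel (adjoint_channel H) = H"
  by (simp add: adjoint_channel_def fun_eq_iff)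

lemma rev_Omega_eq: "rev_Omega L LT H S = fwd_Omega L LT (adjoint_channel H) S"
  by (simp add: fun_eq_iff rev_Omega_def fwd_Omega_def adjoint_channel_def)

lemma rev_grad_eq: "rev_grad L LT H S = fwd_grad L LT (adjoint_channel H) S"
  by (simp add: fun_eq_iff rev_grad_def fwd_grad_def rev_Omega_eq) (simp add: adjoint_channel_def)

lemma rev_denom_eq: "rev_denom L w LT H S = fwd_denom L w LT (adjoint_channel H) S"
  by (simp add: rev_denom_def fwd_denom_def rev_grad_eq)

lemma dla_step_eq:
  "dla_step L w PT LT LR H S = dla_rev L w PT LT (adjoint_channel H) (dla_rev L w PT LR H S)"
  \<comment> \<open>The instantiation with \<open>LT\<close> unfolds only the outer
    \<open>dla_rev\<close> and keeps the inner one folded.\<close>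
  by (simp add: fun_eq_iff dla_step_def dla_rev_def[of _ _ _ LT] Let_def rev_grad_eq rev_denom_eq)

text \<open>The iteration prescribes the new covariances only at indices below \<open>L\<close>, so
  tuples can be compared only there.\<close>

lemma wsr_cong:
  assumes "\<And>l. l < L \<Longrightarrow> S l = S' l"
  shows "wsr L w LR H S = wsr L w LR H S'"
proof -
  have "fwd_Omega L LR H S l = fwd_Omega L LR H S' l" for l
    unfolding fwd_Omega_def by (intro foldr_cong) (auto simp: assms)
  thus ?thesis unfolding wsr_def by (intro sum.cong) (simp_all add: assms)
qed

lemma fwd_Omega_pd:
  assumes H: "\<And>k. k < L \<Longrightarrow> H l k \<in> carrier_mat (LR l) (LT k)"
    and S: "\<And>k. k < L \<Longrightarrow> hermitian_psd (LT k) (S k)"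
  shows "hermitian_pd (LR l) (fwd_Omega L LR H S l)"
proof -
  have "hermitian_pd (LR l) (foldr (\<lambda>k A. H l k * S k * mat_adjoint (H l k) + A) ks (1\<^sub>m (LR l)))"
    if "set ks \<subseteq> {..<L}" for ks
    using that
  proof (induction ks)
    case Nil
    thus ?case by (simp add: hermitian_pd_one)
  next
    case (Cons k ks)
    hence k: "k < L" by simp
    have psd: "hermitian_psd (LR l) (H l k * S k * mat_adjoint (H l k))"
      using hermitian_psd_congruence[OF S[OF k], of "mat_adjoint (H l k)" "LR l"] H[OF k] by simp
    have pd: "hermitian_pd (LR l) (foldr (\<lambda>k A. H l k * S k * mat_adjoint (H l k) + A) ks (1\<^sub>m (LR l)))"
      using Cons by simp
    show ?case
      using hermitian_pd_add_psd[OF pd psd]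
        comm_add_mat[OF hermitian_pdD(1)[OF pd] hermitian_psdD(1)[OF psd]] by simp
  qed
  from this[of "filter (\<lambda>k. k \<noteq> l) [0..<L]"] show ?thesis unfolding fwd_Omega_def by auto
qed

text \<open>The identity summand is the noise and contributes \<open>mtrace X\<close>. Separated
  from the interference, it sums over the links to the total power when \<open>X\<close> runs
  through a tuple of covariances.\<close>

lemma mtrace_mult_fwd_Omega:
  assumes H: "\<And>k. k < L \<Longrightarrow> H l k \<in> carrier_mat (LR l) (LT k)"
    and S: "\<And>k. k < L \<Longrightarrow> S k \<in> carrier_mat (LT k) (LT k)"
    and X: "X \<in> carrier_mat (LR l) (LR l)"
  shows "mtrace (X * fwd_Omega L LR H S l) = mtrace X
    + (\<Sum>k\<in>{..<L} - {l}. mtrace (X * (H l k * S k * mat_adjoint (H l k))))"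
proof -
  let ?F = "\<lambda>ks. foldr (\<lambda>k A. H l k * S k * mat_adjoint (H l k) + A) ks (1\<^sub>m (LR l))"
  \<comment> \<open>The carrier is part of the induction claim because distributivity in the step
    needs the dimensions of the partial sum.\<close>
  have "?F ks \<in> carrier_mat (LR l) (LR l) \<and> mtrace (X * ?F ks) = mtrace X
      + (\<Sum>k\<leftarrow>ks. mtrace (X * (H l k * S k * mat_adjoint (H l k))))"
    if "set ks \<subseteq> {..<L}" for ks
    using that
  proof (induction ks)
    case Nil
    thus ?case using X by simp
  next
    case (Cons k ks)
    hence k: "k < L" by simp
    note IH = Cons.IH[OF order_trans[OF set_subset_Cons Cons.prems]]
    have K: "H l k * S k * mat_adjoint (H l k) \<in> carrier_mat (LR l) (LR l)"
      using H[OF k] by (intro mult_carrier_mat[OF mult_carrier_mat[OF H[OF k] S[OF k]]]) simp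
    have "X * (H l k * S k * mat_adjoint (H l k) + ?F ks)
        = X * (H l k * S k * mat_adjoint (H l k)) + X * ?F ks"
      by (rule mult_add_distrib_mat[OF X K conjunct1[OF IH]])
    thus ?case
      using conjunct1[OF IH] conjunct2[OF IH] K carrier_matD[OF X] carrier_matD[OF K]
        carrier_matD[OF conjunct1[OF IH]]
      by (simp add: mtrace_add)
  qed
  note foldr_trace = this
  let ?ks = "filter (\<lambda>k. k \<noteq> l) [0..<L]"
  have ks: "set ?ks = {..<L} - {l}" "distinct ?ks" by auto
  have "set ?ks \<subseteq> {..<L}" by auto
  from conjunct2[OF foldr_trace[OF this]] show ?thesis
    unfolding fwd_Omega_def sum_list_distinct_conv_sum_set[OF ks(2)] ks(1) .
qed

text \<open>Both halves of one iteration are this map, for the channel and for its adjoint; each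
  half increases the sum-rate of the respective network.\<close>

lemma dla_rev_half_step:
  assumes w: "\<And>l. l < L \<Longrightarrow> 0 < w l" and PT: "0 < PT"
    and H: "\<And>l k. l < L \<Longrightarrow> k < L \<Longrightarrow> H l k \<in> carrier_mat (LR l) (LT k)"
    and S: "\<And>l. l < L \<Longrightarrow> hermitian_psd (LT l) (S l)"
    and trS: "(\<Sum>l<L. mtrace (S l)) = complex_of_real PT"
    and denom: "fwd_denom L w LR H S \<in> \<real>" "0 < Re (fwd_denom L w LR H S)"
  defines "R \<equiv> dla_rev L w PT LR H S"
  shows "\<And>l. l < L \<Longrightarrow> hermitian_psd (LR l) (R l)"
    and "(\<Sum>l<L. mtrace (R l)) = complex_of_real PT"
    and "wsr L w LR H S \<le> wsr L w LT (adjoint_channel H) R"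
proof -
  let ?Ht = "adjoint_channel H"
  let ?Om = "fwd_Omega L LR H S" and ?Oh = "fwd_Omega L LT ?Ht R"
  define d where "d = Re (fwd_denom L w LR H S)"
  have d: "fwd_denom L w LR H S = complex_of_real d" "0 < d"
    using denom by (simp_all add: d_def)
  \<comment> \<open>The scalar in front of each gradient. Since it is \<open>w l\<close> times
    \<open>PT / d\<close>, rates weighted by \<open>c\<close> add up to a fixed positive multiple of
    the weighted sum-rate.\<close>
  define c where "c l = PT * w l / d" for l
  have c: "0 < c l" if "l < L" for l using w[OF that] PT d by (simp add: c_def)
  have Ht: "?Ht l k \<in> carrier_mat (LT l) (LR k)" if "l < L" "k < L" for l k
    using H that by (simp add: adjoint_channel_def)
  have Om: "hermitian_pd (LR l) (?Om l)" if "l < L" for l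
    using that H S by (intro fwd_Omega_pd)
  have grad: "fwd_grad L LR H S l
      = minv (?Om l) - minv (?Om l + mat_adjoint (?Ht l l) * S l * ?Ht l l)" for l
    by (simp add: fwd_grad_def adjoint_channel_def)
  have grad_psd: "hermitian_psd (LR l) (fwd_grad L LR H S l)" if "l < L" for l
    unfolding grad using that by (intro hermitian_psd_minv_diff[OF Om S Ht])
  have R: "R l = complex_of_real (c l) \<cdot>\<^sub>m fwd_grad L LR H S l" for l
    unfolding R_def dla_rev_def d(1) c_def by simp
  show Rpsd: "hermitian_psd (LR l) (R l)" if "l < L" for l
    unfolding R using c[OF that] by (intro hermitian_psd_smult grad_psd that) simp
  have "(\<Sum>l<L. mtrace (R l)) = (\<Sum>l<L. complex_of_real (PT / d) * (complex_of_real (w l) * mtrace (fwd_grad L LR H S l)))"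
    by (intro sum.cong refl) (simp add: R c_def mtrace_smult hermitian_psdD(2,3)[OF grad_psd])
  also have "\<dots> = complex_of_real (PT / d) * fwd_denom L w LR H S"
    by (simp add: fwd_denom_def sum_distrib_left)
  also have "\<dots> = complex_of_real PT" unfolding d(1) using d(2) by simp
  finally show trR: "(\<Sum>l<L. mtrace (R l)) = complex_of_real PT" .
  have Oh: "hermitian_pd (LT l) (?Oh l)" if "l < L" for l
    using that Ht Rpsd by (intro fwd_Omega_pd)
  \<comment> \<open>Cyclicity of the trace: the interference of \<open>R k\<close> in the reversed
    network, weighted by \<open>S l\<close>, equals that of \<open>S l\<close> in the original
    network, weighted by \<open>R k\<close>.\<close>
  have "mtrace (S l * (?Ht l k * R k * mat_adjoint (?Ht l k))) = mtrace (R k * (H k l * S l * mat_adjoint (H k l)))"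
    if "l < L" "k < L" for l k
  proof -
    note dims = carrier_matD[OF H[OF that(2,1)]] hermitian_psdD(2,3)[OF S[OF that(1)]]
      hermitian_psdD(2,3)[OF Rpsd[OF that(2)]]
    have "mtrace ((S l * mat_adjoint (H k l)) * (R k * H k l)) = mtrace ((R k * H k l) * (S l * mat_adjoint (H k l)))"
      by (rule mtrace_mult_commute) (simp_all add: dims)
    thus ?thesis by (simp add: adjoint_channel_def dims mat_assoc)
  qed
  hence cross: "(\<Sum>l<L. \<Sum>k\<in>{..<L} - {l}. mtrace (S l * (?Ht l k * R k * mat_adjoint (?Ht l k))))
      = (\<Sum>l<L. \<Sum>k\<in>{..<L} - {l}. mtrace (R k * (H k l * S l * mat_adjoint (H k l))))"
    by (intro sum.cong refl) auto
  have swap: "(\<Sum>l<L. \<Sum>k\<in>{..<L} - {l}. f l k) = (\<Sum>l<L. \<Sum>k\<in>{..<L} - {l}. f k l)"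
    for f :: "nat \<Rightarrow> nat \<Rightarrow> complex"
  proof -
    \<comment> \<open>Padding the diagonal with zeros makes the index set a full square, where the
      order of summation can be exchanged.\<close>
    have off_diag: "(\<Sum>l<L. \<Sum>k\<in>{..<L} - {l}. g l k) = (\<Sum>l<L. \<Sum>k<L. if k \<noteq> l then g l k else 0)"
      for g :: "nat \<Rightarrow> nat \<Rightarrow> complex"
      by (intro sum.cong refl sum.mono_neutral_cong_left) auto
    show ?thesis unfolding off_diag by (subst sum.swap) (intro sum.cong refl, auto)
  qed
  have "(\<Sum>l<L. mtrace (S l * ?Oh l)) = complex_of_real PT
      + (\<Sum>l<L. \<Sum>k\<in>{..<L} - {l}. mtrace (S l * (?Ht l k * R k * mat_adjoint (?Ht l k))))"
    unfolding trS[symmetric] sum.distrib[symmetric]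
    using Ht Rpsd S by (intro sum.cong refl mtrace_mult_fwd_Omega) (auto intro: hermitian_psdD(1))
  also have "\<dots> = complex_of_real PT
      + (\<Sum>l<L. \<Sum>k\<in>{..<L} - {l}. mtrace (R l * (H l k * S k * mat_adjoint (H l k))))"
    unfolding cross swap[of "\<lambda>l k. mtrace (R k * (H k l * S l * mat_adjoint (H k l)))"] ..
  also have "\<dots> = (\<Sum>l<L. mtrace (R l * ?Om l))"
    unfolding trR[symmetric] sum.distrib[symmetric]
    using H Rpsd S
    by (intro sum.cong refl mtrace_mult_fwd_Omega[symmetric]) (auto intro: hermitian_psdD(1))
  also have "\<dots> = (\<Sum>l<L. mtrace (?Om l * R l))"
    using hermitian_psdD(2,3)[OF Rpsd] hermitian_pdD(2,3)[OF Om]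
    by (intro sum.cong refl mtrace_mult_commute) auto
  finally have traces: "(\<Sum>l<L. mtrace (S l * ?Oh l)) = (\<Sum>l<L. mtrace (?Om l * R l))" .
  \<comment> \<open>The single-link inequality with \<open>\<Theta> = ?Om l\<close>,
    \<open>\<Omega> = ?Oh l\<close>, \<open>\<Lambda> = S l\<close> and channel
    \<open>?Ht l l\<close>; the covariance it constructs is then \<open>R l\<close>.\<close>
  have "c l * (logdet (?Om l + H l l * S l * mat_adjoint (H l l)) - logdet (?Om l))
      \<le> c l * (logdet (?Oh l + ?Ht l l * R l * mat_adjoint (?Ht l l)) - logdet (?Oh l))
        + Re (mtrace (S l * ?Oh l)) - Re (mtrace (?Om l * R l))" if "l < L" for l
    using logdet_duality_scaled[OF Om[OF that] Oh[OF that] S[OF that] Ht[OF that that] c[OF that]]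
    unfolding R[unfolded grad, symmetric] by (simp add: adjoint_channel_def)
  hence "(\<Sum>l<L. c l * (logdet (?Om l + H l l * S l * mat_adjoint (H l l)) - logdet (?Om l)))
      \<le> (\<Sum>l<L. c l * (logdet (?Oh l + ?Ht l l * R l * mat_adjoint (?Ht l l)) - logdet (?Oh l))
        + Re (mtrace (S l * ?Oh l)) - Re (mtrace (?Om l * R l)))"
    by (intro sum_mono) simp
  moreover have "(\<Sum>l<L. Re (mtrace (S l * ?Oh l))) = (\<Sum>l<L. Re (mtrace (?Om l * R l)))"
    using arg_cong[OF traces, of Re] by simp
  ultimately have "PT / d * wsr L w LR H S \<le> PT / d * wsr L w LT ?Ht R"
    by (simp add: wsr_def c_def sum_distrib_left sum.distrib sum_subtractf mult.assoc)
  thus "wsr L w LR H S \<le> wsr L w LT ?Ht R"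
    by (rule mult_left_le_imp_le) (use PT d(2) in simp)
qed

theorem theorem1:
  fixes L :: nat and w :: "nat \<Rightarrow> real" and PT :: real
    and LT LR :: "nat \<Rightarrow> nat" and H :: "nat \<Rightarrow> nat \<Rightarrow> complex mat"
    and Sig :: "nat \<Rightarrow> nat \<Rightarrow> complex mat"
  assumes "L \<ge> 1"
    and "\<forall>l<L. w l > 0"
    and "PT > 0"
    and "\<forall>l<L. \<forall>k<L. H l k \<in> carrier_mat (LR l) (LT k)"
    and "\<forall>l<L. hermitian_psd (LT l) (Sig 0 l)"
    and "(\<Sum>l<L. mtrace (Sig 0 l)) = complex_of_real PT"
    and "\<forall>n. \<forall>l<L. Sig (Suc n) l = dla_step L w PT LT LR H (Sig n) l"
    and "\<forall>n. fwd_denom L w LR H (Sig n) \<in> \<real> \<and> 0 < Re (fwd_denom L w LR H (Sig n))"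
    and "\<forall>n. rev_denom L w LT H (dla_rev L w PT LR H (Sig n)) \<in> \<real> \<and>
             0 < Re (rev_denom L w LT H (dla_rev L w PT LR H (Sig n)))"
  shows "\<forall>n. wsr L w LR H (Sig n) \<le> wsr L w LR H (Sig (Suc n))"
proof -
  \<comment> \<open>The invariant of the iteration: what a half-step requires of its input and again
    guarantees for its output.\<close>
  let ?feasible = "\<lambda>S. (\<forall>l<L. hermitian_psd (LT l) (S l)) \<and> (\<Sum>l<L. mtrace (S l)) = complex_of_real PT"
  have step: "?feasible (Sig (Suc n)) \<and> wsr L w LR H (Sig n) \<le> wsr L w LR H (Sig (Suc n))"
    if feas: "?feasible (Sig n)" for n
  proof -
    define R where "R = dla_rev L w PT LR H (Sig n)"
    define T where "T = dla_rev L w PT LT (adjoint_channel H) R"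
    have Ht: "adjoint_channel H l k \<in> carrier_mat (LT l) (LR k)" if "l < L" "k < L" for l k
      using assms(4) that by (simp add: adjoint_channel_def)
    have T: "Sig (Suc n) l = T l" if "l < L" for l
      using assms(7) that by (simp add: dla_step_eq T_def R_def)
    have "\<And>l. l < L \<Longrightarrow> hermitian_psd (LR l) (R l)" "(\<Sum>l<L. mtrace (R l)) = complex_of_real PT"
      and 1: "wsr L w LR H (Sig n) \<le> wsr L w LT (adjoint_channel H) R"
      unfolding R_def using assms(2-4,8) feas
      by (auto intro: dla_rev_half_step[of L w PT H LR LT "Sig n"])
    moreover have "fwd_denom L w LT (adjoint_channel H) R \<in> \<real>" "0 < Re (fwd_denom L w LT (adjoint_channel H) R)"
      using assms(9) by (simp_all add: R_def rev_denom_eq)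
    \<comment> \<open>The second half-step runs in the reversed network; reversing twice leads back
      to the original channels.\<close>
    ultimately have "\<And>l. l < L \<Longrightarrow> hermitian_psd (LT l) (T l)" "(\<Sum>l<L. mtrace (T l)) = complex_of_real PT"
      and 2: "wsr L w LT (adjoint_channel H) R \<le> wsr L w LR H T"
      unfolding T_def using assms(2,3) Ht
        dla_rev_half_step[of L w PT "adjoint_channel H" LT LR R]
      by simp_all
    moreover have "wsr L w LR H (Sig (Suc n)) = wsr L w LR H T"
      using T by (rule wsr_cong)
    ultimately show ?thesis using 1 T by simp
  qed
  have "?feasible (Sig n)" for n
    by (induction n) (use assms(5,6) step in blast)+
  with step show ?thesis by blast
qed

end
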